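(* Consider the stationary tandem $GI/G/1\to\cdot/G/1\to\cdots\to\cdot/G/1$ of $M$ queues described in the context, with generic inter-arrival time $X$ and service time $Y^{(j)}$ at queue $j$, and put $V^{(j)}:=Y^{(j)}-X$ for $1\le j\le M$; assume $\mathbb{P}(V^{(j)}>0)>0$ for all $j$. Denote by $\mathcal{V}_M(v_1,\ldots,v_M)$ the random vector whose $j$-th component is $\min\{v_j-V^{(j)},v_{j+1}-V^{(j+1)}\}$ for $1\le j\le M-1$ and whose $M$-th component is $v_M-V^{(M)}$. Let $\psi_M(v_1,\ldots,v_M):=\mathbb{P}(T^1_1\le v_1,\ldots,T^M_1\le v_M)$, where, with $(V^{(1)}_k,\ldots,V^{(M)}_k)_{k\ge1}$ i.i.d. copies of $(V^{(1)},\ldots,V^{(M)})$, $$T^j_1:=\sup_{1\le i_j<i_{j-1}<\cdots<i_1<\infty}\left(V^{(j)}_1+\cdots+V^{(j)}_{i_j}+V^{(j-1)}_{i_j+1}+\cdots+V^{(j-1)}_{i_{j-1}}+\cdots+V^{(1)}_{i_2+1}+\cdots+V^{(1)}_{i_1}\right).$$ Let $\gamma_M:\overline{\mathbb{R}}^M\to(-\infty,K_{\gamma_M}]$ ($K_{\gamma_M}$ finite) satisfy $\gamma_M(\infty,\ldots,\infty)=\limsup_{v_1,\ldots,v_M\to\infty}\gamma_M=1$ and $\mathbb{E}[\mathbf{1}_{\{v_1\ge V^{(1)}\}}\gamma_M(\mathcal{V}_M(v_1,\ldots,v_M))]\ge\gamma_M(v_1,\ldots,v_M)$ for all $(v_1,\ldots,v_M)\in\operatorname{supp}(\gamma_M\vee0)$.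 Let $\eta_M:\overline{\mathbb{R}}^M\to[0,\infty)$ satisfy $\eta_M(\infty,\ldots,\infty)=\liminf_{v_1,\ldots,v_M\to\infty}\eta_M=1$ and $\mathbb{E}[\mathbf{1}_{\{v_1\ge V^{(1)}\}}\eta_M(\mathcal{V}_M(v_1,\ldots,v_M))]\le\eta_M(v_1,\ldots,v_M)$ for all $(v_1,\ldots,v_M)\in\operatorname{supp}(\psi_M)$. Then for all $x\ge0$ the stationary end-to-end waiting time $W$ satisfies $$\begin{aligned}&1-\mathbb{E}\left[\eta_M\left(x+\sum_{k=1}^MY^{(M+1-k)}_k-S^1,\ \ldots,\ x+\sum_{k=1}^MY^{(M+1-k)}_k-S^M\right)\right]\le\mathbb{P}(W>x)\\&\qquad\le1-\mathbb{E}\left[\gamma_M\left(x+\sum_{k=1}^MY^{(M+1-k)}_k-S^1,\ \ldots,\ x+\sum_{k=1}^MY^{(M+1-k)}_k-S^M\right)\right],\end{aligned}$$ where $Y^{(j)}_k$ ($1\le j,k\le M$) are independent, $Y^{(j)}_k$ is distributed as $Y^{(j)}$, $S^M:=Y^{(M)}_1+\cdots+Y^{(M)}_M$, and for $1\le j\le M-1$ $$S^j:=\max_{1\le i_M<\cdots<i_{j+1}\le M}\left(Y^{(M)}_1+\cdots+Y^{(M)}_{i_M}+Y^{(M-1)}_{i_M+1}+\cdots+Y^{(M-1)}_{i_{M-1}}+\cdots+Y^{(j)}_{i_{j+1}+1}+\cdots+Y^{(j)}_M\right).$$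
   Context: Model: jobs $0,1,2,\ldots$ traverse $M$ FIFO single-server queues of infinite capacity in series. Job $0$ arrives at time $0$ and job $n$ at time $A_n:=X_0+\cdots+X_{n-1}$. The inter-arrival times $(X_n)$ are i.i.d. copies of $X\ge0$; the service times at queue $j$ of successive jobs are i.i.d. copies of $Y^{(j)}\ge0$; all these sequences are mutually independent. If $s^j_n$ is the service time of job $n$ at queue $j$, its departure time from queue $j$ is $E^j_n=\max\{E^{j-1}_n,E^j_{n-1}\}+s^j_n$, with $E^0_n=A_n$ and $E^j_{-1}=0$. The end-to-end waiting time of job $n$ is $W_n:=E^M_n-A_n-\sum_{j=1}^Ms^j_n$, and $W$ is the limit in distribution of $W_n$ as $n\to\infty$, with $\mathbb{P}(W>x)=\lim_n\mathbb{P}(W_n>x)$. Stability is assumed: $\mathbb{E}[X]>\max_j\mathbb{E}[Y^{(j)}]$; service times are light-tailed ($\mathbb{E}[e^{\theta Y^{(j)}}]<\infty$ for some $\theta>0$). Notation: $\overline{\mathbb{R}}:=\mathbb{R}\cup\{\pm\infty\}$; $\operatorname{supp}(\phi):=\{x:\phi(x)\ne0\}$ and $\operatorname{supp}(\phi\vee0):=\{x:\phi(x)>0\}$. In the definition of $S^j$, empty sums are $0$. All functions are Borel measurable; limits as $v_1,\ldots,v_M\to\infty$ are taken over points of $\overline{\mathbb{R}}^M$ tending to $(\infty,\ldots,\infty)$. *)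

theory Defs
  imports "HOL-Probability.Probability"
begin

text \<open>
  Conventions. Queues are numbered \<open>1, \<dots>, M\<close>. A point of the \<open>M\<close>-fold power of the extended reals is
  an extensional function on \<open>{1..M}\<close>, i.e. an element of \<open>{1..M} \<rightarrow>\<^sub>E UNIV\<close>.
\<close>

text \<open>
  Expectation with values in the extended reals, \<open>E[f\<^sup>+] - E[f\<^sup>-]\<close>. The Bochner integral would return
  0 for a non-integrable function. Here it is only applied to functions bounded from above or from
  below on a probability space, so that \<open>\<infinity> - \<infinity>\<close> does not occur.
\<close>

definition expectation_ext :: "'a measure \<Rightarrow> ('a \<Rightarrow> real) \<Rightarrow> ereal" where
  "expectation_ext N f =
     enn2ereal (\<integral>\<^sup>+\<omega>. ennreal (f \<omega>) \<partial>N) - enn2ereal (\<integral>\<^sup>+\<omega>. ennreal (- f \<omega>) \<partial>N)"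

lemma expectation_ext_integrable:
  assumes "integrable N f"
  shows "expectation_ext N f = ereal (\<integral>\<omega>. f \<omega> \<partial>N)"
proof -
  obtain r q where "0 \<le> r" "0 \<le> q"
    "(\<integral>\<^sup>+\<omega>. ennreal (f \<omega>) \<partial>N) = ennreal r" "(\<integral>\<^sup>+\<omega>. ennreal (- f \<omega>) \<partial>N) = ennreal q"
    "(\<integral>\<omega>. f \<omega> \<partial>N) = r - q"
    using assms by (rule integrableE)
  then show ?thesis
    by (simp add: expectation_ext_def)
qed

text \<open>
  \<open>departure X s j n\<close> is the departure time of job \<open>n\<close> from queue \<open>j\<close>, where \<open>j = 0\<close> gives the arrival
  time; the 0 in the second equation is the departure time of the fictitious job \<open>-1\<close>.
\<close>

fun departure :: "(nat \<Rightarrow> real) \<Rightarrow> (nat \<Rightarrow> nat \<Rightarrow> real) \<Rightarrow> nat \<Rightarrow> nat \<Rightarrow> real" where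
  "departure X s 0 n = (\<Sum>i<n. X i)"
| "departure X s (Suc j) 0 = max (departure X s j 0) 0 + s (Suc j) 0"
| "departure X s (Suc j) (Suc n) =
     max (departure X s j (Suc n)) (departure X s (Suc j) n) + s (Suc j) (Suc n)"

definition waiting_time :: "nat \<Rightarrow> (nat \<Rightarrow> real) \<Rightarrow> (nat \<Rightarrow> nat \<Rightarrow> real) \<Rightarrow> nat \<Rightarrow> real" where
  "waiting_time M X s n = departure X s M n - (\<Sum>i<n. X i) - (\<Sum>j=1..M. s j n)"

text \<open>
  In the next two definitions \<open>V j k\<close> and \<open>y j k\<close> stand for $V^{(j)}_k$ and $Y^{(j)}_k$. The chains
  \<open>1 \<le> i\<^sub>j < \<dots> < i\<^sub>1\<close> and \<open>1 \<le> i\<^sub>M < \<dots> < i\<^sub>j\<^sub>+\<^sub>1 \<le> M\<close> are prolonged by \<open>i\<^sub>j\<^sub>+\<^sub>1 = 0\<close> and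
  \<open>i\<^sub>M\<^sub>+\<^sub>1 = 0\<close>, respectively, so that the block of queue \<open>l\<close> consists of the indices
  \<open>i\<^sub>l\<^sub>+\<^sub>1 + 1, \<dots>, i\<^sub>l\<close>. For \<open>j = M\<close> there is only the chain \<open>i\<^sub>M\<^sub>+\<^sub>1 = 0\<close> and \<open>prefix_max\<close> is
  \<open>y M 1 + \<dots> + y M M\<close>.
\<close>

definition tandem_sup :: "(nat \<Rightarrow> nat \<Rightarrow> real) \<Rightarrow> nat \<Rightarrow> ereal" where
  "tandem_sup V j =
     (SUP i\<in>{i \<in> {1..Suc j} \<rightarrow>\<^sub>E UNIV. i (Suc j) = 0 \<and> (\<forall>l\<in>{1..j}. i (Suc l) < i l)}.
        ereal (\<Sum>l=1..j. \<Sum>k\<in>{i (Suc l)<..i l}. V l k))"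

definition prefix_max :: "nat \<Rightarrow> (nat \<Rightarrow> nat \<Rightarrow> real) \<Rightarrow> nat \<Rightarrow> real" where
  "prefix_max M y j =
     (MAX i\<in>{i \<in> {Suc j..Suc M} \<rightarrow>\<^sub>E {..M}. i (Suc M) = 0 \<and> (\<forall>l\<in>{Suc j..M}. i (Suc l) < i l)}.
        (\<Sum>l=Suc j..M. \<Sum>k\<in>{i (Suc l)<..i l}. y l k) + (\<Sum>k\<in>{i (Suc j)<..M}. y j k))"

definition shift_min :: "nat \<Rightarrow> (nat \<Rightarrow> ereal) \<Rightarrow> (nat \<Rightarrow> real) \<Rightarrow> nat \<Rightarrow> ereal" where
  "shift_min M v V =
     (\<lambda>j\<in>{1..M}. if j < M then min (v j - ereal (V j)) (v (Suc j) - ereal (V (Suc j)))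
                 else v M - ereal (V M))"

definition psi :: "'a measure \<Rightarrow> nat \<Rightarrow> (nat \<Rightarrow> nat \<Rightarrow> 'a \<Rightarrow> real) \<Rightarrow> (nat \<Rightarrow> ereal) \<Rightarrow> real" where
  "psi \<Omega> M V v = \<P>(\<omega> in \<Omega>. \<forall>j\<in>{1..M}. tandem_sup (\<lambda>l k. V l k \<omega>) j \<le> v j)"

abbreviation ereal_vec :: "nat \<Rightarrow> (nat \<Rightarrow> ereal) measure" where
  "ereal_vec M \<equiv> (\<Pi>\<^sub>M j\<in>{1..M}. borel)"

abbreviation infty_vec :: "nat \<Rightarrow> nat \<Rightarrow> ereal" where
  "infty_vec M \<equiv> (\<lambda>j\<in>{1..M}. \<infinity>)"

text \<open>
  Limits \<open>v\<^sub>1, \<dots>, v\<^sub>M \<rightarrow> \<infinity>\<close> in the product topology; as usual, the limit point itself is excluded.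
\<close>

abbreviation to_infty :: "nat \<Rightarrow> (nat \<Rightarrow> ereal) filter" where
  "to_infty M \<equiv> at (infty_vec M) within ({1..M} \<rightarrow>\<^sub>E UNIV)"

end

theory Submission
  imports Defs "HOL-Real_Asymp.Real_Asymp"
begin

text \<open>
  Read backwards in time, the condition that job \<open>n\<close> waits at most \<open>x\<close> is
  a condition on a vector of \<open>M\<close> deadlines, one for each queue. A departure is a
  service time plus the maximum of two departures on the next diagonal \<open>job + queue =
  const\<close> of the network, and bounding a maximum means bounding both of its arguments; hence
  passing to the next diagonal turns the deadline vector \<open>v\<close> into \<open>shift_min M v
  u\<close>, where \<open>u\<close> is an independent copy of \<open>V\<close>, and demands \<open>u
  1 \<le> v 1\<close> in addition (queue 1 is fed by the arrivals). So \<open>waiting_time M X s n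
  \<le> x\<close> says that a killed random walk with these transitions survives \<open>n\<close>
  steps (\<open>waiting_time_le_iff_survives\<close>). The first \<open>M\<close> diagonals meet no
  arrival except the one of job \<open>n\<close> itself, and they produce the starting vector with
  the entries $x + \sum_k Y^{(M+1-k)}_k - S^j$. The variables $T^j_1$ unfold the same recursion, so
  that \<open>psi\<close> is the probability of surviving for ever
  (\<open>psi_eq_eternal_prob\<close>). Survival of \<open>n\<close> steps decreases in
  \<open>n\<close>, so the distribution functions of the \<open>waiting_time\<close> decrease and
  their weak limit is the pointwise one; this gives \<open>P(W \<le> x) = E[psi(starting
  vector)]\<close> (\<open>emeasure_stationary_waiting_time_le\<close>).

  It remains to see that \<open>\<gamma> \<le> psi \<le> \<eta>\<close> at vectors without the entry
  \<open>-\<infinity>\<close>. Let \<open>P\<close> be the one-step operator of the killed walk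
  (\<open>step\<close>). Then \<open>P psi = psi\<close>, the powers \<open>P^n 1\<close> decrease
  to \<open>psi\<close>, the positive part of \<open>\<gamma>\<close> is subharmonic and
  \<open>\<eta>\<close>, set to 0 where \<open>psi\<close> vanishes, is superharmonic. The boundary
  condition at infinity is used through a Lyapunov function: because service times are light-tailed
  and \<open>E[V] < 0\<close>, there is \<open>\<theta> > 0\<close> with \<open>E[exp (\<theta> V)]
  < 1\<close> for every queue, and a weighted sum \<open>L\<close> of \<open>exp (- \<theta>
  v\<^sub>j)\<close> satisfies \<open>P L \<le> r L\<close> with \<open>r < 1\<close>. As
  \<open>L\<close> is small only near infinity, the hypotheses give \<open>\<gamma> \<le> 1 +
  \<epsilon> + C L\<close> and \<open>(1 - \<epsilon>) psi \<le> \<eta> + C L\<close>. Applying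
  \<open>P^n\<close> multiplies the error term by \<open>r^n\<close>, and \<open>n \<rightarrow>
  \<infinity>\<close>, \<open>\<epsilon> \<rightarrow> 0\<close> yield both inequalities
  (\<open>subharmonic_le_eternal_prob\<close>, \<open>eternal_prob_le_superharmonic\<close>).
\<close>

section \<open>Finite-horizon survival and chains\<close>

lemma shift_min_cong:
  assumes "\<And>j. j \<in> {1..M} \<Longrightarrow> v j = v' j" "\<And>j. j \<in> {1..M} \<Longrightarrow> w j = w' j"
  shows "shift_min M v w = shift_min M v' w'"
  using assms by (auto simp: shift_min_def fun_eq_iff restrict_def)

text \<open>
  The walk starts in the deadline vector \<open>v\<close> and is driven by the steps \<open>u 0\<close>, \<open>u 1\<close>, \dots; it is
  killed at the first step that exceeds the first coordinate.
\<close>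

primrec survives :: "nat \<Rightarrow> nat \<Rightarrow> (nat \<Rightarrow> ereal) \<Rightarrow> (nat \<Rightarrow> nat \<Rightarrow> real) \<Rightarrow> bool" where
  "survives M 0 v u = True"
| "survives M (Suc n) v u \<longleftrightarrow>
     ereal (u 0 1) \<le> v 1 \<and> survives M n (shift_min M v (u 0)) (\<lambda>k. u (Suc k))"

text \<open>
  Stated with sets \<open>B j\<close> of bounded numbers because for a finite horizon, and in particular for
  horizon 0, the set of chain sums may be empty.
\<close>

lemma shift_min_le_iff:
  assumes "1 \<le> M"
  shows "(\<forall>j\<in>{1..M}. \<forall>t\<in>B j. ereal t \<le> shift_min M v w j) \<longleftrightarrow>
    (\<forall>j\<in>{1..M}. \<forall>t\<in>B j. ereal (w j + t) \<le> v j) \<and>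
    (\<forall>j\<in>{1..<M}. \<forall>t\<in>B j. ereal (w (Suc j) + t) \<le> v (Suc j))"
proof -
  have *: "ereal t \<le> a - ereal r \<longleftrightarrow> ereal (r + t) \<le> a" for a t r
    by (cases a) auto
  have "{1..M} = insert M {1..<M}" using assms by auto
  then show ?thesis by (auto simp: shift_min_def *)
qed

text \<open>
  The chains and the sums of \<open>tandem_sup\<close>, also for \<open>j = 0\<close>, where the only sum is the empty one.
  That convention makes the recursion below uniform in \<open>j\<close>: the condition \<open>V 1 1 \<le> v 1\<close> is
  the contribution of \<open>j = 0\<close>.
\<close>

definition tandem_chains :: "nat \<Rightarrow> (nat \<Rightarrow> nat) set" where
  "tandem_chains j = {i \<in> {1..Suc j} \<rightarrow>\<^sub>E UNIV. i (Suc j) = 0 \<and> (\<forall>l\<in>{1..j}. i (Suc l) < i l)}"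

definition chain_sum :: "(nat \<Rightarrow> nat \<Rightarrow> real) \<Rightarrow> nat \<Rightarrow> (nat \<Rightarrow> nat) \<Rightarrow> real" where
  "chain_sum V j i = (\<Sum>l=1..j. \<Sum>k\<in>{i (Suc l)<..i l}. V l k)"

text \<open>
  Moves every index by one and restarts the chain at 0. It maps chains of queue \<open>j\<close> as well as
  chains of queue \<open>j - 1\<close> to chains of queue \<open>j\<close>, because the index 1 always belongs to the block of
  queue \<open>j\<close>.
\<close>

definition lift_chain :: "nat \<Rightarrow> (nat \<Rightarrow> nat) \<Rightarrow> nat \<Rightarrow> nat" where
  "lift_chain j i = (\<lambda>l\<in>{1..Suc j}. if l = Suc j then 0 else Suc (i l))"

lemma image_Suc_greaterThanAtMost: "Suc ` {a<..b} = {Suc a<..Suc b}"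
  by (simp add: atLeastSucAtMost_greaterThanAtMost[symmetric])

lemma chain_sum_lift:
  assumes "i \<in> tandem_chains j \<union> tandem_chains (Suc j)"
  shows "chain_sum V (Suc j) (lift_chain (Suc j) i) =
    V (Suc j) 1 + (if i \<in> tandem_chains j then chain_sum (\<lambda>l k. V l (Suc k)) j i
                   else chain_sum (\<lambda>l k. V l (Suc k)) (Suc j) i)"
proof -
  let ?i = "lift_chain (Suc j) i"
  have inner: "(\<Sum>k\<in>{?i (Suc l)<..?i l}. V l k) = (\<Sum>k\<in>{i (Suc l)<..i l}. V l (Suc k))"
    if "l \<in> {1..j}" for l
  proof -
    have "{?i (Suc l)<..?i l} = Suc ` {i (Suc l)<..i l}"
      using that by (auto simp: lift_chain_def image_Suc_greaterThanAtMost)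
    then show ?thesis by (simp add: sum.reindex)
  qed
  have last: "(\<Sum>k\<in>{?i (Suc (Suc j))<..?i (Suc j)}. V (Suc j) k) =
      V (Suc j) 1 + (\<Sum>k\<in>{0<..i (Suc j)}. V (Suc j) (Suc k))"
  proof -
    have "{?i (Suc (Suc j))<..?i (Suc j)} = insert 1 (Suc ` {0<..i (Suc j)})"
      by (auto simp: lift_chain_def image_Suc_greaterThanAtMost)
    moreover have "1 \<notin> Suc ` {0<..i (Suc j)}" by auto
    ultimately show ?thesis by (simp only: sum.insert finite_imageI finite_greaterThanAtMost) (simp add: sum.reindex)
  qed
  have sum_lift: "chain_sum V (Suc j) ?i = chain_sum (\<lambda>l k. V l (Suc k)) j i
      + (V (Suc j) 1 + (\<Sum>k\<in>{0<..i (Suc j)}. V (Suc j) (Suc k)))"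
    unfolding chain_sum_def using inner by (simp add: last)
  show ?thesis
  proof (cases "i \<in> tandem_chains j")
    case True
    then have "i (Suc j) = 0" by (simp add: tandem_chains_def)
    with True show ?thesis by (simp add: sum_lift)
  next
    case False
    with assms have "i \<in> tandem_chains (Suc j)" by blast
    then have "i (Suc (Suc j)) = 0" by (simp add: tandem_chains_def)
    then have "chain_sum (\<lambda>l k. V l (Suc k)) (Suc j) i =
       chain_sum (\<lambda>l k. V l (Suc k)) j i + (\<Sum>k\<in>{0<..i (Suc j)}. V (Suc j) (Suc k))"
      by (simp add: chain_sum_def)
    with False show ?thesis by (simp add: sum_lift)
  qed
qed

text \<open>
  The inverse of \<open>lift_chain\<close> subtracts 1 from every index. If the block of the top queue is the
  single index 1, that block disappears and the result is a chain of the previous queue. The bound on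
  \<open>i 1\<close> drops from \<open>Suc n\<close> to \<open>n\<close>, so the identity can drive an induction on the horizon.
\<close>

lemma tandem_chains_Suc:
  "{i \<in> tandem_chains (Suc j). i 1 \<le> Suc n} =
     lift_chain (Suc j) ` ({i \<in> tandem_chains j. i 1 \<le> n} \<union> {i \<in> tandem_chains (Suc j). i 1 \<le> n})"
proof (intro subset_antisym subsetI)
  fix i' assume "i' \<in> lift_chain (Suc j) ` ({i \<in> tandem_chains j. i 1 \<le> n} \<union> {i \<in> tandem_chains (Suc j). i 1 \<le> n})"
  then obtain i where i: "i' = lift_chain (Suc j) i" "i \<in> tandem_chains j \<or> i \<in> tandem_chains (Suc j)" "i 1 \<le> n"
    by auto
  have "i' (Suc l) < i' l" if "l \<in> {1..Suc j}" for l
    using i(2) that by (cases "l = Suc j") (auto simp: i(1) lift_chain_def tandem_chains_def Ball_def)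
  then show "i' \<in> {i \<in> tandem_chains (Suc j). i 1 \<le> Suc n}"
    using i(3) by (auto simp: i(1) lift_chain_def tandem_chains_def)
next
  fix i assume "i \<in> {i \<in> tandem_chains (Suc j). i 1 \<le> Suc n}"
  then have i: "i \<in> {1..Suc (Suc j)} \<rightarrow>\<^sub>E UNIV" "i (Suc (Suc j)) = 0"
      "\<And>l. 1 \<le> l \<Longrightarrow> l \<le> Suc j \<Longrightarrow> i (Suc l) < i l" "i 1 \<le> Suc n"
    by (auto simp: tandem_chains_def)
  have pos: "0 < i l" if "1 \<le> l" "l \<le> Suc j" for l
    using i(3)[OF that] by simp
  define J where "J = (if i (Suc j) = 1 then j else Suc j)"
  define i' where "i' = (\<lambda>l\<in>{1..Suc J}. i l - 1)"
  have "lift_chain (Suc j) i' = i"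
  proof
    fix l
    have "i l = undefined" if "l \<notin> {1..Suc (Suc j)}"
      using i(1) that by (auto simp: PiE_iff extensional_def)
    then show "lift_chain (Suc j) i' l = i l"
      using pos[of l] i(2) by (auto simp: lift_chain_def i'_def J_def)
  qed
  moreover have "i' \<in> tandem_chains J"
  proof -
    have "i' (Suc l) < i' l" if "l \<in> {1..J}" for l
    proof -
      have l: "1 \<le> l" "l \<le> Suc j" using that by (auto simp: J_def split: if_splits)
      have "i (Suc l) < i l" by (rule i(3)[OF l])
      moreover have "1 < i l"
      proof (cases "l = Suc j")
        case True then show ?thesis
          using that pos[of l] by (auto simp: J_def split: if_splits)
      next
        case False then show ?thesis
          using pos[of "Suc l"] l i(3)[OF l] by auto
      qed
      ultimately show ?thesis using that by (auto simp: i'_def)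
    qed
    then show ?thesis using i(2) by (auto simp: tandem_chains_def i'_def J_def)
  qed
  moreover have "i' 1 \<le> n" using i(4) by (auto simp: i'_def)
  moreover have "J = j \<or> J = Suc j" by (auto simp: J_def)
  ultimately show "i \<in> lift_chain (Suc j) ` ({i \<in> tandem_chains j. i 1 \<le> n} \<union> {i \<in> tandem_chains (Suc j). i 1 \<le> n})"
    by (metis (mono_tags, lifting) UnI1 UnI2 image_eqI mem_Collect_eq)
qed

lemma tandem_chains_disjoint: "tandem_chains j \<inter> tandem_chains (Suc j) = {}"
  by (force simp: tandem_chains_def)

definition chain_sums :: "(nat \<Rightarrow> nat \<Rightarrow> real) \<Rightarrow> nat \<Rightarrow> nat \<Rightarrow> real set" where
  "chain_sums V n j = chain_sum V j ` {i \<in> tandem_chains j. i 1 \<le> n}"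

lemma chain_sums_0: "chain_sums V n 0 = {0}"
proof -
  have "(\<lambda>l\<in>{1..Suc 0}. 0) \<in> {i \<in> tandem_chains 0. i 1 \<le> n}" by (auto simp: tandem_chains_def)
  then show ?thesis by (auto simp: chain_sums_def chain_sum_def)
qed

lemma chain_sums_Suc:
  "chain_sums V (Suc n) (Suc j) =
     (+) (V (Suc j) 1) ` (chain_sums (\<lambda>l k. V l (Suc k)) n j
                          \<union> chain_sums (\<lambda>l k. V l (Suc k)) n (Suc j))"
proof -
  have "chain_sum V (Suc j) (lift_chain (Suc j) i) = V (Suc j) 1 + chain_sum (\<lambda>l k. V l (Suc k)) j i"
    if "i \<in> tandem_chains j" for i
    using that chain_sum_lift[of i j V] by auto
  moreover have "chain_sum V (Suc j) (lift_chain (Suc j) i) =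
      V (Suc j) 1 + chain_sum (\<lambda>l k. V l (Suc k)) (Suc j) i"
    if "i \<in> tandem_chains (Suc j)" for i
    using that chain_sum_lift[of i j V] tandem_chains_disjoint[of j] by auto
  ultimately show ?thesis
    unfolding chain_sums_def tandem_chains_Suc
    by (simp add: image_Un image_image cong: image_cong_simp)
qed

text \<open>
  Both sides obey the same recursion: \<open>chain_sums_Suc\<close> says that bounding the sums of queue
  \<open>Suc j\<close> by \<open>v (Suc j)\<close> bounds the remaining sums of the queues \<open>j\<close> and \<open>Suc j\<close> by
  \<open>v (Suc j) - V (Suc j) 1\<close>, which is what \<open>shift_min\<close> records coordinatewise.
\<close>

lemma survives_iff_chain_sums:
  assumes "1 \<le> M"
  shows "survives M n v (\<lambda>k j. V j (Suc k)) \<longleftrightarrow>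
    (\<forall>j\<in>{1..M}. \<forall>t\<in>chain_sums V n j. ereal t \<le> v j)"
proof (induction n arbitrary: v V)
  case 0
  have "chain_sums V 0 j = {}" if "j \<in> {1..M}" for j
    using that by (auto simp: chain_sums_def tandem_chains_def Ball_def dest!: spec[of _ "1::nat"])
  then show ?case by simp
next
  case (Suc n)
  let ?V = "\<lambda>l k. V l (Suc k)"
  have "(\<forall>j\<in>{1..M}. \<forall>t\<in>chain_sums V (Suc n) j. ereal t \<le> v j) \<longleftrightarrow>
     (\<forall>j\<in>{0..<M}. \<forall>t\<in>chain_sums V (Suc n) (Suc j). ereal t \<le> v (Suc j))"
    by (simp add: image_Suc_atLeastLessThan[symmetric] atLeastLessThanSuc_atLeastAtMost[symmetric]
          del: image_Suc_atLeastLessThan)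
  also have "\<dots> \<longleftrightarrow> (\<forall>j\<in>{0..<M}. \<forall>t\<in>chain_sums ?V n j. ereal (V (Suc j) 1 + t) \<le> v (Suc j)) \<and>
      (\<forall>j\<in>{0..<M}. \<forall>t\<in>chain_sums ?V n (Suc j). ereal (V (Suc j) 1 + t) \<le> v (Suc j))"
    by (auto simp: chain_sums_Suc)
  also have "(\<forall>j\<in>{0..<M}. \<forall>t\<in>chain_sums ?V n (Suc j). ereal (V (Suc j) 1 + t) \<le> v (Suc j)) \<longleftrightarrow>
     (\<forall>j\<in>{1..M}. \<forall>t\<in>chain_sums ?V n j. ereal (V j 1 + t) \<le> v j)"
    by (simp add: image_Suc_atLeastLessThan[symmetric] atLeastLessThanSuc_atLeastAtMost[symmetric]
          del: image_Suc_atLeastLessThan)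
  also have "(\<forall>j\<in>{0..<M}. \<forall>t\<in>chain_sums ?V n j. ereal (V (Suc j) 1 + t) \<le> v (Suc j)) \<longleftrightarrow>
     ereal (V 1 1) \<le> v 1 \<and>
     (\<forall>j\<in>{1..<M}. \<forall>t\<in>chain_sums ?V n j. ereal (V (Suc j) 1 + t) \<le> v (Suc j))"
  proof -
    have "{0..<M} = insert 0 {1..<M}" using assms by auto
    then show ?thesis by (simp add: chain_sums_0)
  qed
  finally show ?case
    using Suc.IH[of "shift_min M v (\<lambda>j. V j (Suc 0))" ?V] shift_min_le_iff[OF assms, of "chain_sums ?V n" v "\<lambda>j. V j (Suc 0)"]
    by auto
qed

lemma survives_cong:
  assumes "1 \<le> M" "\<And>k j. j \<in> {1..M} \<Longrightarrow> u k j = u' k j"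
  shows "survives M n v u \<longleftrightarrow> survives M n v u'"
  using assms(2)
proof (induction n arbitrary: v u u')
  case (Suc n)
  have "shift_min M v (u 0) = shift_min M v (u' 0)"
    using Suc.prems by (intro shift_min_cong) auto
  with Suc.IH[of "\<lambda>k. u (Suc k)" "\<lambda>k. u' (Suc k)"] Suc.prems assms(1) show ?case by simp
qed simp

lemma tandem_sup_le_iff_survives:
  assumes "1 \<le> M"
  shows "(\<forall>j\<in>{1..M}. tandem_sup V j \<le> v j) \<longleftrightarrow>
    (\<forall>n. survives M n v (\<lambda>k. \<lambda>j\<in>{1..M}. V j (Suc k)))"
proof -
  have "tandem_sup V j \<le> v j \<longleftrightarrow> (\<forall>n. \<forall>t\<in>chain_sums V n j. ereal t \<le> v j)" for j
    by (auto simp: tandem_sup_def SUP_le_iff chain_sums_def tandem_chains_def chain_sum_def)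
  moreover have "survives M n v (\<lambda>k. \<lambda>j\<in>{1..M}. V j (Suc k)) \<longleftrightarrow>
      survives M n v (\<lambda>k j. V j (Suc k))" for n
    by (rule survives_cong[OF assms]) simp
  ultimately show ?thesis
    by (auto simp: survives_iff_chain_sums[OF assms])
qed

lemma survives_antimono: "survives M (Suc n) v u \<Longrightarrow> survives M n v u"
  by (induction n arbitrary: v u) auto

section \<open>The network as a backward recursion along diagonals\<close>

text \<open>
  The departures on the diagonal that contains the pairs (queue \<open>j\<close>, job \<open>c - j\<close>). Queues with
  \<open>j > c\<close> would refer to negative jobs and impose nothing.
\<close>

definition deadlines_met :: "nat \<Rightarrow> (nat \<Rightarrow> real) \<Rightarrow> (nat \<Rightarrow> nat \<Rightarrow> real) \<Rightarrow> nat \<Rightarrow> (nat \<Rightarrow> ereal) \<Rightarrow> bool" where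
  "deadlines_met M X s c v \<longleftrightarrow> (\<forall>j\<in>{1..M}. j \<le> c \<longrightarrow> ereal (departure X s j (c - j)) \<le> v j)"

text \<open>
  Job 0 sees the fictitious departure time 0 of job \<open>-1\<close>; nonnegativity makes that maximum harmless,
  which is why the lower end of the diagonals needs no separate treatment.
\<close>

lemma departure_0_nonneg:
  assumes "\<And>j. j \<in> {1..M} \<Longrightarrow> 0 \<le> s j 0"
  shows "j \<le> M \<Longrightarrow> 0 \<le> departure X s j 0"
  using assms by (induction j) auto

lemma departure_recursion:
  assumes "\<And>j. j \<in> {1..M} \<Longrightarrow> 0 \<le> s j 0" "Suc j \<in> {1..M}" "j \<le> c"
  shows "ereal (departure X s (Suc j) (c - j)) \<le> v \<longleftrightarrow>
     ereal (departure X s j (c - j)) \<le> v - ereal (s (Suc j) (c - j)) \<and>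
     (Suc j \<le> c \<longrightarrow> ereal (departure X s (Suc j) (c - Suc j)) \<le> v - ereal (s (Suc j) (c - j)))"
proof (cases "c = j")
  case True
  have "0 \<le> departure X s j 0" by (rule departure_0_nonneg[of M]) (use assms in auto)
  with True show ?thesis by (cases v) auto
next
  case False
  with assms(3) obtain m where "c - j = Suc m" "c - Suc j = m"
    by (metis Suc_diff_Suc le_neq_implies_less)
  then show ?thesis using False assms(3) by (cases v) (auto simp: max_def)
qed

text \<open>
  Each departure is a maximum of two departures on the next diagonal plus a service time. The
  queue \<open>j\<close> of the next diagonal is reached from queue \<open>j\<close> (previous job) and from queue \<open>j + 1\<close>
  (same job), hence the minimum in \<open>shift_min\<close>; queue 1 also waits for an arrival.
\<close>

lemma deadlines_met_Suc:
  assumes M: "1 \<le> M" and s: "\<And>j. j \<in> {1..M} \<Longrightarrow> 0 \<le> s j 0"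
    and w: "\<And>j. j \<in> {1..M} \<Longrightarrow> j \<le> Suc c \<Longrightarrow> w j = s j (Suc c - j)"
  shows "deadlines_met M X s (Suc c) v \<longleftrightarrow>
    ereal ((\<Sum>i<c. X i) + w 1) \<le> v 1 \<and> deadlines_met M X s c (shift_min M v w)"
proof -
  let ?E = "\<lambda>j m. ereal (departure X s j m)"
  have "deadlines_met M X s (Suc c) v \<longleftrightarrow>
      (\<forall>j\<in>{0..<M}. j \<le> c \<longrightarrow> ?E (Suc j) (c - j) \<le> v (Suc j))"
    unfolding deadlines_met_def
    by (simp add: image_Suc_atLeastLessThan[symmetric] atLeastLessThanSuc_atLeastAtMost[symmetric]
          del: image_Suc_atLeastLessThan departure.simps)
  also have "\<dots> \<longleftrightarrow> (\<forall>j\<in>{0..<M}. j \<le> c \<longrightarrow> ?E j (c - j) \<le> v (Suc j) - ereal (w (Suc j)) \<and>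
     (Suc j \<le> c \<longrightarrow> ?E (Suc j) (c - Suc j) \<le> v (Suc j) - ereal (w (Suc j))))"
  proof (intro ball_cong refl imp_cong)
    fix j assume "j \<in> {0..<M}" "j \<le> c"
    then show "(?E (Suc j) (c - j) \<le> v (Suc j)) = (?E j (c - j) \<le> v (Suc j) - ereal (w (Suc j)) \<and>
     (Suc j \<le> c \<longrightarrow> ?E (Suc j) (c - Suc j) \<le> v (Suc j) - ereal (w (Suc j))))"
      using departure_recursion[of M s j c X "v (Suc j)"] s w[of "Suc j"] by simp
  qed
  also have "\<dots> \<longleftrightarrow> (\<forall>j\<in>{0..<M}. j \<le> c \<longrightarrow> ?E j (c - j) \<le> v (Suc j) - ereal (w (Suc j))) \<and>
     (\<forall>j\<in>{0..<M}. Suc j \<le> c \<longrightarrow> ?E (Suc j) (c - Suc j) \<le> v (Suc j) - ereal (w (Suc j)))"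
    by (auto simp del: departure.simps)
  also have "(\<forall>j\<in>{0..<M}. Suc j \<le> c \<longrightarrow> ?E (Suc j) (c - Suc j) \<le> v (Suc j) - ereal (w (Suc j))) \<longleftrightarrow>
     (\<forall>j\<in>{1..M}. j \<le> c \<longrightarrow> ?E j (c - j) \<le> v j - ereal (w j))"
    by (simp add: image_Suc_atLeastLessThan[symmetric] atLeastLessThanSuc_atLeastAtMost[symmetric]
          del: image_Suc_atLeastLessThan departure.simps)
  also have "(\<forall>j\<in>{0..<M}. j \<le> c \<longrightarrow> ?E j (c - j) \<le> v (Suc j) - ereal (w (Suc j))) \<longleftrightarrow>
     ereal (\<Sum>i<c. X i) \<le> v 1 - ereal (w 1) \<and>
     (\<forall>j\<in>{1..<M}. j \<le> c \<longrightarrow> ?E j (c - j) \<le> v (Suc j) - ereal (w (Suc j)))"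
  proof -
    have "{0..<M} = insert 0 {1..<M}" using M by auto
    then show ?thesis by simp
  qed
  also have "ereal (\<Sum>i<c. X i) \<le> v 1 - ereal (w 1) \<longleftrightarrow> ereal ((\<Sum>i<c. X i) + w 1) \<le> v 1"
    by (cases "v 1") auto
  also have "(ereal ((\<Sum>i<c. X i) + w 1) \<le> v 1 \<and>
       (\<forall>j\<in>{1..<M}. j \<le> c \<longrightarrow> ?E j (c - j) \<le> v (Suc j) - ereal (w (Suc j)))) \<and>
       (\<forall>j\<in>{1..M}. j \<le> c \<longrightarrow> ?E j (c - j) \<le> v j - ereal (w j)) \<longleftrightarrow>
     ereal ((\<Sum>i<c. X i) + w 1) \<le> v 1 \<and> deadlines_met M X s c (shift_min M v w)"
  proof -
    have "{1..M} = insert M {1..<M}" using M by auto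
    then show ?thesis
      unfolding deadlines_met_def by (auto simp: shift_min_def simp del: departure.simps)
  qed
  finally show ?thesis .
qed

lemma min_add_ereal: "min (a + ereal r) (b + ereal r) = min a b + ereal r"
  by (cases a; cases b) (auto simp: min_def)

text \<open>
  Measuring deadlines relative to the arrival time of job \<open>c\<close> turns service times into the
  increments of the walk and the arrival condition into \<open>u 0 1 \<le> v 1\<close>. The values of \<open>u k\<close>
  at positions that correspond to negative jobs are arbitrary, so they may later be filled with
  independent variables.
\<close>

lemma deadlines_met_iff_survives:
  assumes M: "1 \<le> M" and s: "\<And>j. j \<in> {1..M} \<Longrightarrow> 0 \<le> s j 0"
    and u: "\<And>k j. k < c \<Longrightarrow> j \<in> {1..M} \<Longrightarrow> j + k \<le> c \<Longrightarrow> u k j = s j (c - j - k) - X (c - 1 - k)"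
  shows "deadlines_met M X s c (\<lambda>j. v j + ereal (\<Sum>i<c. X i)) \<longleftrightarrow> survives M c v u"
  using u
proof (induction c arbitrary: v u)
  case 0
  then show ?case by (auto simp: deadlines_met_def)
next
  case (Suc c)
  \<comment> \<open>Where the step belongs to an existing job this is its service time.\<close>
  define w where "w j = u 0 j + X c" for j
  have "deadlines_met M X s (Suc c) (\<lambda>j. v j + ereal (\<Sum>i<Suc c. X i)) \<longleftrightarrow>
     ereal ((\<Sum>i<c. X i) + w 1) \<le> v 1 + ereal (\<Sum>i<Suc c. X i) \<and>
     deadlines_met M X s c (shift_min M (\<lambda>j. v j + ereal (\<Sum>i<Suc c. X i)) w)"
    by (rule deadlines_met_Suc[where s = s, OF M s]) (use Suc.prems[of 0] in \<open>auto simp: w_def\<close>)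
  also have "ereal ((\<Sum>i<c. X i) + w 1) \<le> v 1 + ereal (\<Sum>i<Suc c. X i) \<longleftrightarrow> ereal (u 0 1) \<le> v 1"
    by (cases "v 1") (auto simp: w_def)
  also have "deadlines_met M X s c (shift_min M (\<lambda>j. v j + ereal (\<Sum>i<Suc c. X i)) w) \<longleftrightarrow>
    deadlines_met M X s c (\<lambda>j. shift_min M v (u 0) j + ereal (\<Sum>i<c. X i))"
  proof -
    have *: "a + ereal (\<Sum>i<Suc c. X i) - ereal (w j) = (a - ereal (u 0 j)) + ereal (\<Sum>i<c. X i)" for a j
      by (cases a) (auto simp: w_def)
    have "shift_min M (\<lambda>j. v j + ereal (\<Sum>i<Suc c. X i)) w j = 
       shift_min M v (u 0) j + ereal (\<Sum>i<c. X i)" if "j \<in> {1..M}" for j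
      using that unfolding shift_min_def by (simp add: * min_add_ereal del: sum.lessThan_Suc)
    then show ?thesis by (simp add: deadlines_met_def)
  qed
  also have "\<dots> \<longleftrightarrow> survives M c (shift_min M v (u 0)) (\<lambda>k. u (Suc k))"
    by (rule Suc.IH) (use Suc.prems in \<open>auto simp: Suc_diff_le\<close>)
  finally show ?case by simp
qed

text \<open>
  The deadlines generated by the single requirement that job \<open>n\<close> leaves queue \<open>M\<close> by time \<open>b\<close>,
  after \<open>k\<close> diagonals; \<open>\<infinity>\<close> marks a queue without a deadline.
\<close>

primrec boundary :: "nat \<Rightarrow> real \<Rightarrow> (nat \<Rightarrow> nat \<Rightarrow> real) \<Rightarrow> nat \<Rightarrow> nat \<Rightarrow> ereal" where
  "boundary M b y 0 = (\<lambda>j\<in>{1..M}. if j = M then ereal b else \<infinity>)"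
| "boundary M b y (Suc k) = shift_min M (boundary M b y k) (\<lambda>j. y j (Suc k))"

text \<open>
  In the triangle of jobs later than \<open>n\<close> there are no deadlines, and on its edge stands what job \<open>n\<close>
  itself has left after the services at the queues \<open>M\<close>, \<open>M - 1\<close>, \dots
\<close>

lemma boundary_diagonal:
  assumes "k < M"
  shows "j \<in> {1..<M - k} \<Longrightarrow> boundary M b y k j = \<infinity>"
    and "boundary M b y k (M - k) = ereal (b - (\<Sum>l=1..k. y (M + 1 - l) l))"
  using assms
proof (induction k arbitrary: j)
  case 0
  { case 1 then show ?case by auto }
  { case 2 then show ?case by auto }
next
  case (Suc k)
  { case 1
    then show ?case using Suc.IH(1)[of j] Suc.IH(1)[of "Suc j"]
      by (auto simp: shift_min_def) }
  { case 2
    have "boundary M b y k (M - Suc k) = \<infinity>" by (rule Suc.IH(1)) (use 2 in auto)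
    moreover have "Suc (M - Suc k) = M - k" using 2 by auto
    moreover have "Suc M - Suc k = M - k" by auto
    ultimately show ?case using 2 Suc.IH(2) by (auto simp: shift_min_def min_def) }
qed

text \<open>
  The recursion is started on the diagonal that also contains jobs later than \<open>n\<close>, because these are
  real jobs without deadlines. Within the first \<open>M\<close> steps queue 1 gets a deadline only on the last of
  them; the arrival condition there is the one of job \<open>n\<close>, and it holds by the assumption on \<open>b\<close>.
\<close>

lemma deadlines_met_boundary:
  assumes M: "1 \<le> M" and s: "\<And>j. j \<in> {1..M} \<Longrightarrow> 0 \<le> s j 0"
    and y: "\<And>k j. k \<in> {1..M} \<Longrightarrow> j \<in> {1..M} \<Longrightarrow> j + k \<le> n + M + 1 \<Longrightarrow> y j k = s j (n + M + 1 - j - k)"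
    and b: "(\<Sum>i<n. X i) + (\<Sum>l=1..M. y (M + 1 - l) l) \<le> b"
  shows "ereal (departure X s M n) \<le> ereal b \<longleftrightarrow> deadlines_met M X s n (boundary M b y M)"
proof -
  have "k \<le> M \<Longrightarrow> ereal (departure X s M n) \<le> ereal b \<longleftrightarrow>
      deadlines_met M X s (n + M - k) (boundary M b y k)" for k
  proof (induction k)
    case 0
    have "{1..M} = insert M {1..<M}" using M by auto
    then show ?case by (auto simp: deadlines_met_def)
  next
    case (Suc k)
    have eq: "n + M - k = Suc (n + M - Suc k)" using Suc.prems by auto
    have "deadlines_met M X s (n + M - k) (boundary M b y k) \<longleftrightarrow>
       ereal ((\<Sum>i<n + M - Suc k. X i) + y 1 (Suc k)) \<le> boundary M b y k 1 \<and>
       deadlines_met M X s (n + M - Suc k) (shift_min M (boundary M b y k) (\<lambda>j. y j (Suc k)))"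
      unfolding eq using Suc.prems by (intro deadlines_met_Suc[where s = s, OF M s]) (auto simp: y eq[symmetric] add.commute)
    moreover have "ereal ((\<Sum>i<n + M - Suc k. X i) + y 1 (Suc k)) \<le> boundary M b y k 1"
    proof (cases "Suc k = M")
      case False
      then have "boundary M b y k 1 = \<infinity>" using Suc.prems by (intro boundary_diagonal(1)) auto
      then show ?thesis by simp
    next
      case True
      then have "M - k = 1" by auto
      then have "boundary M b y k 1 = ereal (b - (\<Sum>l=1..k. y (M + 1 - l) l))"
        using boundary_diagonal(2)[of k M b y] Suc.prems by simp
      then show ?thesis using b True by (auto simp: algebra_simps)
    qed
    ultimately show ?case using Suc by simp
  qed
  from this[of M] show ?thesis by simp
qed

definition prefix_chains :: "nat \<Rightarrow> nat \<Rightarrow> nat \<Rightarrow> (nat \<Rightarrow> nat) set" where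
  "prefix_chains M n j =
     {i \<in> {Suc j..Suc M} \<rightarrow>\<^sub>E {..n}. i (Suc M) = 0 \<and> (\<forall>l\<in>{Suc j..M}. i (Suc l) < i l)}"

definition prefix_sum :: "nat \<Rightarrow> (nat \<Rightarrow> nat \<Rightarrow> real) \<Rightarrow> nat \<Rightarrow> nat \<Rightarrow> (nat \<Rightarrow> nat) \<Rightarrow> real" where
  "prefix_sum M y n j i =
     (\<Sum>l=Suc j..M. \<Sum>k\<in>{i (Suc l)<..i l}. y l k) + (\<Sum>k\<in>{i (Suc j)<..n}. y j k)"

lemma prefix_chain_less:
  assumes "i \<in> prefix_chains M n j" "l \<le> Suc M"
  shows "Suc j < l \<Longrightarrow> i l < i (Suc j)"
  using assms(2)
proof (induction l)
  case (Suc l)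
  then have "i (Suc l) < i l" using assms(1) by (auto simp: prefix_chains_def)
  with Suc show ?case by (cases "l = Suc j") auto
qed simp

lemma prefix_chains_Suc_self: "prefix_chains M (Suc n) M = prefix_chains M n M"
  by (auto simp: prefix_chains_def PiE_iff)

text \<open>
  A chain up to \<open>n + 1\<close> whose last block (of queue \<open>j\<close>) is empty is one of queue \<open>j + 1\<close> that uses
  the index \<open>n + 1\<close> itself; all others stay below \<open>n + 1\<close>.
\<close>

lemma prefix_chains_Suc:
  assumes "j < M"
  shows "prefix_chains M (Suc n) j =
    prefix_chains M n j \<union> (\<lambda>i. i(Suc j := Suc n)) ` prefix_chains M n (Suc j)"
proof (intro subset_antisym subsetI)
  fix i assume i: "i \<in> prefix_chains M (Suc n) j"
  note less = prefix_chain_less[OF i]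
  show "i \<in> prefix_chains M n j \<union> (\<lambda>i. i(Suc j := Suc n)) ` prefix_chains M n (Suc j)"
  proof (cases "i (Suc j) = Suc n")
    case False
    have "i l \<le> n" if "l \<in> {Suc j..Suc M}" for l
    proof (cases "l = Suc j")
      case True then show ?thesis using False i that by (auto simp: prefix_chains_def PiE_iff le_Suc_eq)
    next
      case False
      then have "i l < i (Suc j)" using less[of l] that by simp
      moreover have "i (Suc j) \<le> Suc n" using i that by (auto simp: prefix_chains_def PiE_iff)
      ultimately show ?thesis by simp
    qed
    then show ?thesis using i by (auto simp: prefix_chains_def PiE_iff)
  next
    case True
    let ?i = "restrict i {Suc (Suc j)..Suc M}"
    have "?i \<in> prefix_chains M n (Suc j)"
      using i less True assms by (auto simp: prefix_chains_def less_Suc_eq_le)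
    moreover have "?i(Suc j := Suc n) = i"
    proof
      fix l show "(?i(Suc j := Suc n)) l = i l"
        using True i by (cases "l = Suc j") (auto simp: prefix_chains_def PiE_iff extensional_def)
    qed
    ultimately show ?thesis by (metis UnI2 imageI)
  qed
next
  fix i assume "i \<in> prefix_chains M n j \<union> (\<lambda>i. i(Suc j := Suc n)) ` prefix_chains M n (Suc j)"
  then show "i \<in> prefix_chains M (Suc n) j"
  proof
    assume "i \<in> prefix_chains M n j"
    then show ?thesis by (auto simp: prefix_chains_def PiE_iff)
  next
    assume "i \<in> (\<lambda>i. i(Suc j := Suc n)) ` prefix_chains M n (Suc j)"
    then obtain i' where i': "i = i'(Suc j := Suc n)" "i' \<in> prefix_chains M n (Suc j)" by auto
    then show ?thesis using assms
      by (auto simp: prefix_chains_def PiE_iff extensional_def less_Suc_eq_le intro!: le_SucI)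
  qed
qed

lemma INF_ereal_const_add: "(INF i\<in>I. ereal c + f i) = ereal c + (INF i\<in>I. f i)"
proof (cases "I = {}")
  case False
  have "(INF i\<in>I. ereal c - (- f i)) = ereal c - (SUP i\<in>I. - f i)"
    by (rule INF_ereal_minus_right) (use False in auto)
  then show ?thesis by (simp add: minus_ereal_def ereal_SUP_uminus_eq)
qed (simp add: top_ereal_def)

text \<open>
  The infimum is written in the extended reals because there are no chains, hence the value \<open>\<infinity>\<close>, as long
  as fewer than \<open>M - j\<close> diagonals have been passed.
\<close>

lemma boundary_eq_INF:
  assumes "j \<in> {1..M}"
  shows "boundary M b y n j = (INF i\<in>prefix_chains M n j. ereal (b - prefix_sum M y n j i))"
  using assms
proof (induction n arbitrary: j)
  case 0
  show ?case
  proof (cases "j = M")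
    case True
    have "prefix_chains M 0 M = {\<lambda>l\<in>{Suc M}. 0}"
      by (auto simp: prefix_chains_def PiE_iff extensional_def fun_eq_iff)
    then show ?thesis using 0 True by (simp add: prefix_sum_def)
  next
    case False
    then have "prefix_chains M 0 j = {}" using 0 by (force simp: prefix_chains_def PiE_iff)
    then show ?thesis using 0 False by (simp add: top_ereal_def)
  qed
next
  case (Suc n)
  have stay: "(INF i\<in>prefix_chains M n j. ereal (b - prefix_sum M y (Suc n) j i)) =
      boundary M b y n j - ereal (y j (Suc n))" if j: "j \<in> {1..M}" for j
  proof -
    have "ereal (b - prefix_sum M y (Suc n) j i) =
        - ereal (y j (Suc n)) + ereal (b - prefix_sum M y n j i)"
      if "i \<in> prefix_chains M n j" for i
    proof -
      have "i (Suc j) \<le> n" using that j by (auto simp: prefix_chains_def PiE_iff)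
      then have "{i (Suc j)<..Suc n} = insert (Suc n) {i (Suc j)<..n}" by auto
      then show ?thesis by (simp add: prefix_sum_def)
    qed
    then have "(INF i\<in>prefix_chains M n j. ereal (b - prefix_sum M y (Suc n) j i)) =
        (INF i\<in>prefix_chains M n j. ereal (- y j (Suc n)) + ereal (b - prefix_sum M y n j i))"
      by (intro INF_cong) auto
    also have "\<dots> = ereal (- y j (Suc n)) + (INF i\<in>prefix_chains M n j. ereal (b - prefix_sum M y n j i))"
      by (rule INF_ereal_const_add)
    finally show ?thesis using Suc.IH[OF j] by (simp add: minus_ereal_def add.commute)
  qed
  show ?case
  proof (cases "j = M")
    case True
    then show ?thesis using stay[of j] Suc.prems by (simp add: prefix_chains_Suc_self shift_min_def)
  next
    case False
    with Suc.prems have j: "j < M" by auto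
    have "prefix_sum M y (Suc n) j (i(Suc j := Suc n)) = prefix_sum M y (Suc n) (Suc j) i"
      if "i \<in> prefix_chains M n (Suc j)" for i
    proof -
      have "{Suc j..M} = insert (Suc j) {Suc (Suc j)..M}" using j by auto
      then show ?thesis by (simp add: prefix_sum_def)
    qed
    then have "(INF i\<in>prefix_chains M n (Suc j). ereal (b - prefix_sum M y (Suc n) j (i(Suc j := Suc n)))) =
        (INF i\<in>prefix_chains M n (Suc j). ereal (b - prefix_sum M y (Suc n) (Suc j) i))"
      by (intro INF_cong) auto
    then have "(INF i\<in>prefix_chains M (Suc n) j. ereal (b - prefix_sum M y (Suc n) j i)) =
       min (INF i\<in>prefix_chains M n j. ereal (b - prefix_sum M y (Suc n) j i))
         (INF i\<in>prefix_chains M n (Suc j). ereal (b - prefix_sum M y (Suc n) (Suc j) i))"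
      unfolding prefix_chains_Suc[OF j] by (simp add: INF_union image_image inf_min)
    then show ?thesis using stay[of j] stay[of "Suc j"] j Suc.prems by (simp add: shift_min_def)
  qed
qed

lemma finite_prefix_chains: "finite (prefix_chains M n j)"
  unfolding prefix_chains_def by (rule finite_subset[OF _ finite_PiE[of "{Suc j..Suc M}" "\<lambda>_. {..n}"]]) auto

lemma prefix_chains_nonempty:
  assumes "j \<in> {1..M}"
  shows "prefix_chains M M j \<noteq> {}"
proof -
  have "(\<lambda>l\<in>{Suc j..Suc M}. Suc M - l) \<in> prefix_chains M M j"
    using assms by (auto simp: prefix_chains_def)
  then show ?thesis by blast
qed

lemma prefix_max_eq: "prefix_max M y j = Max (prefix_sum M y M j ` prefix_chains M M j)"
  by (simp add: prefix_max_def prefix_sum_def[abs_def] prefix_chains_def)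

lemma boundary_eq_prefix_max:
  assumes j: "j \<in> {1..M}"
  shows "boundary M b y M j = ereal (b - prefix_max M y j)"
proof -
  let ?S = "prefix_sum M y M j ` prefix_chains M M j"
  have fin: "finite ?S" "?S \<noteq> {}"
    using finite_prefix_chains prefix_chains_nonempty[OF j] by auto
  have "(INF i\<in>prefix_chains M M j. ereal (b - prefix_sum M y M j i)) = ereal (b - Max ?S)"
  proof (rule antisym)
    obtain i where "i \<in> prefix_chains M M j" "prefix_sum M y M j i = Max ?S"
      using Max_in[OF fin] by auto
    then show "(INF i\<in>prefix_chains M M j. ereal (b - prefix_sum M y M j i)) \<le> ereal (b - Max ?S)"
      by (metis INF_lower)
    show "ereal (b - Max ?S) \<le> (INF i\<in>prefix_chains M M j. ereal (b - prefix_sum M y M j i))"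
      by (rule INF_greatest) (use fin in auto)
  qed
  then show ?thesis by (simp add: boundary_eq_INF[OF j] prefix_max_eq)
qed

text \<open>
  Only the jobs up to \<open>n\<close> matter. The index of the job at queue \<open>j\<close> on diagonal \<open>k\<close> is \<open>n + M + 1 - j - k\<close>;
  the arrays \<open>y\<close> (the first \<open>M\<close> diagonals) and \<open>u\<close> (the later ones) are constrained only
  where that number is meaningful.
\<close>

lemma waiting_time_le_iff_survives:
  assumes M: "1 \<le> M" and s: "\<And>j. j \<in> {1..M} \<Longrightarrow> 0 \<le> s j 0" and x: "0 \<le> x"
    and y: "\<And>k j. k \<in> {1..M} \<Longrightarrow> j \<in> {1..M} \<Longrightarrow> j + k \<le> n + M + 1 \<Longrightarrow> y j k = s j (n + M + 1 - j - k)"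
    and u: "\<And>k j. k < n \<Longrightarrow> j \<in> {1..M} \<Longrightarrow> j + k \<le> n \<Longrightarrow> u k j = s j (n - j - k) - X (n - 1 - k)"
  shows "waiting_time M X s n \<le> x \<longleftrightarrow>
    survives M n (\<lambda>j\<in>{1..M}. ereal (x + (\<Sum>k=1..M. y (M + 1 - k) k) - prefix_max M y j)) u"
proof -
  let ?A = "\<Sum>i<n. X i" and ?Y = "\<Sum>k=1..M. y (M + 1 - k) k"
  let ?v = "\<lambda>j\<in>{1..M}. ereal (x + ?Y - prefix_max M y j)"
  have Y: "?Y = (\<Sum>j=1..M. s j n)"
  proof -
    have "y (M + 1 - k) k = s (M + 1 - k) n" if "k \<in> {1..M}" for k
    proof -
      have "M + 1 - k \<in> {1..M}" "M + 1 - k + k \<le> n + M + 1" "n + M + 1 - (M + 1 - k) - k = n"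
        using that unfolding atLeastAtMost_iff by arith+
      then show ?thesis using that y[of k "M + 1 - k"] by simp
    qed
    then have "?Y = (\<Sum>k=1..M. s (M + 1 - k) n)" by (intro sum.cong) auto
    also have "\<dots> = (\<Sum>j=1..M. s j n)"
      by (rule sum.reindex_bij_witness[of _ "\<lambda>j. M + 1 - j" "\<lambda>j. M + 1 - j"]) auto
    finally show ?thesis .
  qed
  have "waiting_time M X s n \<le> x \<longleftrightarrow> ereal (departure X s M n) \<le> ereal (x + ?Y + ?A)"
    unfolding waiting_time_def Y ereal_less_eq by linarith
  also have "\<dots> \<longleftrightarrow> deadlines_met M X s n (boundary M (x + ?Y + ?A) y M)"
    by (rule deadlines_met_boundary[OF M s y]) (use x in auto)
  also have "\<dots> \<longleftrightarrow> deadlines_met M X s n (\<lambda>j. ?v j + ereal ?A)"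
    by (simp add: deadlines_met_def boundary_eq_prefix_max algebra_simps)
  also have "\<dots> \<longleftrightarrow> survives M n ?v u"
    by (rule deadlines_met_iff_survives[OF M s u])
  finally show ?thesis .
qed

section \<open>The one-step operator\<close>

text \<open>
  The killed random walk on deadline vectors whose steps have the law \<open>\<mu>\<close>.
\<close>

locale tandem_steps = prob_space \<mu> for \<mu> :: "(nat \<Rightarrow> real) measure" +
  fixes M :: nat
  assumes M: "1 \<le> M" and sets_\<mu> [measurable_cong]: "sets \<mu> = sets (\<Pi>\<^sub>M j\<in>{1..M}. borel)"
begin

declare One_nat_def [simp del]

lemma one_in [simp]: "1 \<in> {1..M}"
  using M by simp

lemma space_ereal_vec: "space (ereal_vec M) = {1..M} \<rightarrow>\<^sub>E UNIV"
  by (simp add: space_PiM)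

lemma shift_min_in_space [simp]: "shift_min M v w \<in> space (ereal_vec M)"
  unfolding space_ereal_vec by (auto simp: shift_min_def)

lemma shift_min_measurable:
  assumes "f \<in> N \<rightarrow>\<^sub>M ereal_vec M" "g \<in> N \<rightarrow>\<^sub>M \<mu>"
  shows "(\<lambda>x. shift_min M (f x) (g x)) \<in> N \<rightarrow>\<^sub>M ereal_vec M"
proof -
  note [measurable] = assms
  have *: "(\<lambda>x. f x j - ereal (g x j)) \<in> borel_measurable N" if "j \<in> {1..M}" for j
  proof -
    have [measurable]: "(\<lambda>u. u j) \<in> borel_measurable \<mu>"
      using that by measurable
    have [measurable]: "(\<lambda>u. u j) \<in> borel_measurable (ereal_vec M)"
      using that by measurable
    show ?thesis by measurable
  qed
  show ?thesis
    unfolding shift_min_def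
  proof (rule measurable_restrict)
    fix j assume j: "j \<in> {1..M}"
    show "(\<lambda>x. if j < M then min (f x j - ereal (g x j)) (f x (Suc j) - ereal (g x (Suc j)))
        else f x M - ereal (g x M)) \<in> borel_measurable N"
      using *[of j] *[of "Suc j"] *[of M] j M by (cases "j < M") auto
  qed
qed

lemma admit_measurable:
  assumes "f \<in> N \<rightarrow>\<^sub>M ereal_vec M" "g \<in> N \<rightarrow>\<^sub>M \<mu>"
  shows "Measurable.pred N (\<lambda>x. ereal (g x 1) \<le> f x 1)"
proof -
  note [measurable] = assms
  have [measurable]: "(\<lambda>u. u 1) \<in> borel_measurable \<mu>"
    unfolding measurable_cong_sets[OF sets_\<mu> refl] by (rule measurable_component_singleton[OF one_in])
  have [measurable]: "(\<lambda>u. u 1) \<in> borel_measurable (ereal_vec M)"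
    by (rule measurable_component_singleton[OF one_in])
  show ?thesis by measurable
qed

text \<open>
  Values in \<open>ennreal\<close> let all functions of interest, including a Lyapunov function with
  infinite values, be treated without integrability conditions.
\<close>

definition step :: "((nat \<Rightarrow> ereal) \<Rightarrow> ennreal) \<Rightarrow> (nat \<Rightarrow> ereal) \<Rightarrow> ennreal" where
  "step f v = (\<integral>\<^sup>+u. (if ereal (u 1) \<le> v 1 then f (shift_min M v u) else 0) \<partial>\<mu>)"

lemma step_integrand_measurable:
  assumes "f \<in> borel_measurable (ereal_vec M)"
  shows "(\<lambda>(v, u). if ereal (u 1) \<le> v 1 then f (shift_min M v u) else 0)
    \<in> borel_measurable (ereal_vec M \<Otimes>\<^sub>M \<mu>)"
  unfolding case_prod_beta
proof (rule measurable_If)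
  show "{x \<in> space (ereal_vec M \<Otimes>\<^sub>M \<mu>). ereal (snd x 1) \<le> fst x 1} \<in> sets (ereal_vec M \<Otimes>\<^sub>M \<mu>)"
    using admit_measurable[OF measurable_fst measurable_snd] by (simp add: pred_def)
qed (auto intro!: measurable_compose[OF shift_min_measurable assms])

lemma step_integrand_measurable':
  assumes "f \<in> borel_measurable (ereal_vec M)" "v \<in> space (ereal_vec M)"
  shows "(\<lambda>u. if ereal (u 1) \<le> v 1 then f (shift_min M v u) else 0) \<in> borel_measurable \<mu>"
  using measurable_compose[OF measurable_Pair1' step_integrand_measurable[OF assms(1)], OF assms(2)] by simp

lemma step_measurable:
  assumes "f \<in> borel_measurable (ereal_vec M)"
  shows "step f \<in> borel_measurable (ereal_vec M)"
  unfolding step_def using borel_measurable_nn_integral[OF step_integrand_measurable[OF assms]] .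

lemma step_mono:
  assumes "\<And>v. v \<in> space (ereal_vec M) \<Longrightarrow> f v \<le> g v"
  shows "step f v \<le> step g v"
  unfolding step_def by (intro nn_integral_mono) (auto intro: assms)

lemma step_add:
  assumes "f \<in> borel_measurable (ereal_vec M)" "g \<in> borel_measurable (ereal_vec M)" "v \<in> space (ereal_vec M)"
  shows "step (\<lambda>v. f v + g v) v = step f v + step g v"
  unfolding step_def
  by (subst nn_integral_add[symmetric])
     (auto intro!: nn_integral_cong step_integrand_measurable' assms)

lemma step_cmult:
  assumes "f \<in> borel_measurable (ereal_vec M)" "v \<in> space (ereal_vec M)"
  shows "step (\<lambda>v. c * f v) v = c * step f v"
  unfolding step_def
  by (subst nn_integral_cmult[symmetric])
     (auto intro!: nn_integral_cong step_integrand_measurable' assms)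

lemma steps_measurable:
  assumes "f \<in> borel_measurable (ereal_vec M)"
  shows "(step ^^ n) f \<in> borel_measurable (ereal_vec M)"
  by (induction n) (auto intro: step_measurable assms)

lemma steps_mono:
  assumes "\<And>v. v \<in> space (ereal_vec M) \<Longrightarrow> f v \<le> g v" "v \<in> space (ereal_vec M)"
  shows "(step ^^ n) f v \<le> (step ^^ n) g v"
  using assms(2) by (induction n arbitrary: v) (auto intro: step_mono assms(1))

lemma step_cong:
  assumes "\<And>v. v \<in> space (ereal_vec M) \<Longrightarrow> f v = g v"
  shows "step f v = step g v"
  unfolding step_def by (intro nn_integral_cong) (auto simp: assms)

lemma steps_add:
  assumes "f \<in> borel_measurable (ereal_vec M)" "g \<in> borel_measurable (ereal_vec M)" "v \<in> space (ereal_vec M)"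
  shows "(step ^^ n) (\<lambda>v. f v + g v) v = (step ^^ n) f v + (step ^^ n) g v"
  using assms(3)
proof (induction n arbitrary: v)
  case (Suc n)
  then have "step ((step ^^ n) (\<lambda>v. f v + g v)) v = step (\<lambda>v. (step ^^ n) f v + (step ^^ n) g v) v"
    by (intro step_cong) auto
  also have "\<dots> = step ((step ^^ n) f) v + step ((step ^^ n) g) v"
    by (rule step_add[OF steps_measurable steps_measurable]) (use assms Suc in auto)
  finally show ?case by simp
qed simp

lemma steps_cmult:
  assumes "f \<in> borel_measurable (ereal_vec M)" "v \<in> space (ereal_vec M)"
  shows "(step ^^ n) (\<lambda>v. c * f v) v = c * (step ^^ n) f v"
  using assms(2)
proof (induction n arbitrary: v)
  case (Suc n)
  then have "step ((step ^^ n) (\<lambda>v. c * f v)) v = step (\<lambda>v. c * (step ^^ n) f v) v"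
    by (intro step_cong) auto
  also have "\<dots> = c * step ((step ^^ n) f) v"
    by (rule step_cmult[OF steps_measurable]) (use assms Suc in auto)
  finally show ?case by simp
qed simp

definition survival_prob :: "nat \<Rightarrow> (nat \<Rightarrow> ereal) \<Rightarrow> ennreal" where
  "survival_prob n = (step ^^ n) (\<lambda>_. 1)"

text \<open>
  Defined as the limit of the survival probabilities, so that measurability and harmonicity come
  from the operator; its probabilistic meaning follows from \<open>emeasure_survives_forever\<close>.
\<close>

definition eternal_prob :: "(nat \<Rightarrow> ereal) \<Rightarrow> ennreal" where
  "eternal_prob v = (INF n. survival_prob n v)"

lemma survival_prob_measurable [measurable]: "survival_prob n \<in> borel_measurable (ereal_vec M)"
  unfolding survival_prob_def by (intro steps_measurable) auto

lemma eternal_prob_measurable [measurable]: "eternal_prob \<in> borel_measurable (ereal_vec M)"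
  unfolding eternal_prob_def by measurable

lemma survival_prob_Suc: "survival_prob (Suc n) = step (survival_prob n)"
  by (simp add: survival_prob_def)

lemma survival_prob_le_1: "v \<in> space (ereal_vec M) \<Longrightarrow> survival_prob n v \<le> 1"
proof (induction n arbitrary: v)
  case (Suc n)
  have "step (survival_prob n) v \<le> (\<integral>\<^sup>+u. 1 \<partial>\<mu>)"
    unfolding step_def by (intro nn_integral_mono) (auto intro: Suc)
  then show ?case by (simp add: survival_prob_Suc emeasure_space_1)
qed (simp add: survival_prob_def)

lemma survival_prob_decreasing:
  "v \<in> space (ereal_vec M) \<Longrightarrow> survival_prob (Suc n) v \<le> survival_prob n v"
proof (induction n arbitrary: v)
  case 0
  then show ?case using survival_prob_le_1[of v "Suc 0"] by (simp add: survival_prob_def)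
next
  case (Suc n)
  then show ?case unfolding survival_prob_Suc[of "Suc n"] survival_prob_Suc[of n] by (intro step_mono)
qed

lemma decseq_survival_prob: "v \<in> space (ereal_vec M) \<Longrightarrow> decseq (\<lambda>n. survival_prob n v)"
  by (intro decseq_SucI survival_prob_decreasing)

lemma eternal_prob_le_1: "v \<in> space (ereal_vec M) \<Longrightarrow> eternal_prob v \<le> 1"
  unfolding eternal_prob_def by (rule INF_lower2[of 0]) (auto simp: survival_prob_le_1)

text \<open>
  Monotone convergence: the survival probabilities decrease and are bounded by 1.
\<close>

lemma step_eternal_prob:
  assumes "v \<in> space (ereal_vec M)"
  shows "step eternal_prob v = eternal_prob v"
proof -
  have "step eternal_prob v =
      (\<integral>\<^sup>+u. (INF n. if ereal (u 1) \<le> v 1 then survival_prob n (shift_min M v u) else 0) \<partial>\<mu>)"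
    unfolding step_def eternal_prob_def by (intro nn_integral_cong) auto
  also have "\<dots> = (INF n. step (survival_prob n) v)"
    unfolding step_def
  proof (rule nn_integral_monotone_convergence_INF_decseq)
    show "decseq (\<lambda>n u. if ereal (u 1) \<le> v 1 then survival_prob n (shift_min M v u) else 0)"
      by (intro decseq_SucI le_funI) (simp add: survival_prob_decreasing)
    show "(\<lambda>u. if ereal (u 1) \<le> v 1 then survival_prob n (shift_min M v u) else 0) \<in> borel_measurable \<mu>" for n
      by (rule step_integrand_measurable'[OF survival_prob_measurable assms])
    have "(\<integral>\<^sup>+u. (if ereal (u 1) \<le> v 1 then survival_prob 0 (shift_min M v u) else 0) \<partial>\<mu>) \<le> 1"
      using survival_prob_le_1[OF assms, of 1] unfolding One_nat_def survival_prob_Suc step_def .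
    then show "(\<integral>\<^sup>+u. (if ereal (u 1) \<le> v 1 then survival_prob 0 (shift_min M v u) else 0) \<partial>\<mu>) < \<infinity>"
      by (rule le_less_trans) auto
  qed
  also have "\<dots> = (INF n. survival_prob (Suc n) v)" by (simp add: survival_prob_Suc)
  also have "\<dots> = eternal_prob v"
    unfolding eternal_prob_def
  proof (rule INF_eq)
    show "\<exists>m\<in>UNIV. survival_prob m v \<le> survival_prob (Suc n) v" for n by blast
    show "\<exists>m\<in>UNIV. survival_prob (Suc m) v \<le> survival_prob n v" for n
      using survival_prob_decreasing[OF assms] by blast
  qed
  finally show ?thesis .
qed

lemma steps_eternal_prob:
  "v \<in> space (ereal_vec M) \<Longrightarrow> (step ^^ n) eternal_prob v = eternal_prob v"
proof (induction n arbitrary: v)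
  case (Suc n)
  have "step ((step ^^ n) eternal_prob) v = step eternal_prob v"
    by (intro step_cong Suc.IH)
  then show ?case using step_eternal_prob[OF Suc.prems] by simp
qed simp

lemma survives_measurable:
  assumes "f \<in> N \<rightarrow>\<^sub>M ereal_vec M" "g \<in> N \<rightarrow>\<^sub>M (\<Pi>\<^sub>M k\<in>UNIV. \<mu>)"
  shows "Measurable.pred N (\<lambda>x. survives M n (f x) (g x))"
  using assms
proof (induction n arbitrary: f g)
  case (Suc n)
  have g0: "(\<lambda>x. g x 0) \<in> N \<rightarrow>\<^sub>M \<mu>"
    using measurable_compose[OF Suc.prems(2) measurable_component_singleton[of 0 UNIV "\<lambda>_. \<mu>"]] by simp
  have gS: "(\<lambda>x k. g x (Suc k)) \<in> N \<rightarrow>\<^sub>M (\<Pi>\<^sub>M k\<in>UNIV. \<mu>)"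
  proof (rule measurable_PiM_single')
    show "(\<lambda>x. g x (Suc k)) \<in> N \<rightarrow>\<^sub>M \<mu>" for k
      using measurable_compose[OF Suc.prems(2) measurable_component_singleton[of "Suc k" UNIV "\<lambda>_. \<mu>"]] by simp
    show "(\<lambda>x k. g x (Suc k)) \<in> space N \<rightarrow> UNIV \<rightarrow>\<^sub>E space \<mu>"
      using measurable_space[OF Suc.prems(2)] by (auto simp: space_PiM)
  qed
  show ?case
    unfolding survives.simps
    by (intro pred_intros_logic admit_measurable[OF Suc.prems(1) g0] Suc.IH shift_min_measurable
        Suc.prems(1) g0 gS)
qed simp

text \<open>
  An i.i.d. sequence is its first entry followed by an independent copy of the sequence, which is
  the one-step analysis behind the definition of \<open>step\<close>.
\<close>

lemma emeasure_survives:
  assumes "v \<in> space (ereal_vec M)"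
  shows "emeasure (\<Pi>\<^sub>M k\<in>UNIV. \<mu>) {u \<in> space (\<Pi>\<^sub>M k\<in>UNIV. \<mu>). survives M n v u} = survival_prob n v"
proof -
  let ?S = "\<Pi>\<^sub>M k\<in>(UNIV::nat set). \<mu>"
  interpret S: sequence_space \<mu> by unfold_locales
  have meas: "(\<lambda>u. indicator {u. survives M n v u} u :: ennreal) \<in> borel_measurable ?S"
    if "v \<in> space (ereal_vec M)" for v n
    using survives_measurable[of "\<lambda>_. v" ?S "\<lambda>u. u" n] that
    by (subst borel_measurable_indicator_iff) (auto simp: pred_def Int_def conj_commute)
  have "(\<integral>\<^sup>+u. indicator {u. survives M n v u} u \<partial>?S) = survival_prob n v"
    using assms
  proof (induction n arbitrary: v)
    case 0
    then show ?case by (simp add: survival_prob_def S.P.emeasure_space_1)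
  next
    case (Suc n)
    let ?I = "\<lambda>n v. (\<lambda>u. indicator {u. survives M n v u} u :: ennreal)"
    have "(\<integral>\<^sup>+u. ?I (Suc n) v u \<partial>?S) =
       (\<integral>\<^sup>+u. ?I (Suc n) v u \<partial>distr (\<mu> \<Otimes>\<^sub>M ?S) ?S (\<lambda>(s, \<omega>). case_nat s \<omega>))"
      by (simp only: S.PiM_iter)
    also have "\<dots> = (\<integral>\<^sup>+p. ?I (Suc n) v (case_nat (fst p) (snd p)) \<partial>(\<mu> \<Otimes>\<^sub>M ?S))"
      using meas[OF Suc.prems, of "Suc n"]
      by (subst nn_integral_distr) (simp_all add: case_prod_beta del: survives.simps)
    also have "\<dots> = (\<integral>\<^sup>+s. \<integral>\<^sup>+\<omega>. ?I (Suc n) v (case_nat s \<omega>) \<partial>?S \<partial>\<mu>)"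
      using measurable_compose[OF _ meas[OF Suc.prems, of "Suc n"], of "\<lambda>p. case_nat (fst p) (snd p)" "\<mu> \<Otimes>\<^sub>M ?S"]
      by (subst S.P.nn_integral_fst[symmetric]) (simp_all del: survives.simps)
    also have "\<dots> = (\<integral>\<^sup>+s. (if ereal (s 1) \<le> v 1 then \<integral>\<^sup>+\<omega>. ?I n (shift_min M v s) \<omega> \<partial>?S else 0) \<partial>\<mu>)"
      by (intro nn_integral_cong) (auto simp: indicator_def)
    also have "\<dots> = step (survival_prob n) v"
      unfolding step_def by (intro nn_integral_cong) (auto simp: Suc.IH)
    finally show ?case by (simp add: survival_prob_Suc)
  qed
  moreover have "{u \<in> space ?S. survives M n v u} \<in> sets ?S"
    using survives_measurable[of "\<lambda>_. v" ?S "\<lambda>u. u" n] assms by (auto simp: pred_def)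
  then have "(\<integral>\<^sup>+u. indicator {u \<in> space ?S. survives M n v u} u \<partial>?S) =
      emeasure ?S {u \<in> space ?S. survives M n v u}"
    by (rule nn_integral_indicator)
  moreover have "(\<integral>\<^sup>+u. indicator {u \<in> space ?S. survives M n v u} u \<partial>?S) =
      (\<integral>\<^sup>+u. indicator {u. survives M n v u} u \<partial>?S)"
    by (intro nn_integral_cong) (auto simp: indicator_def)
  ultimately show ?thesis by simp
qed

end

section \<open>A geometric Lyapunov function and the comparison principle\<close>

text \<open>
  The function \<open>exp (- \<theta> v)\<close> on the extended reals.
\<close>

definition exp_decay :: "real \<Rightarrow> ereal \<Rightarrow> ennreal" where
  "exp_decay \<theta> v =
     (if v = \<infinity> then 0 else if v = -\<infinity> then \<infinity> else ennreal (exp (- \<theta> * real_of_ereal v)))"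

lemma exp_decay_measurable [measurable]: "exp_decay \<theta> \<in> borel_measurable borel"
  unfolding exp_decay_def by measurable

lemma exp_decay_diff: "exp_decay \<theta> (v - ereal t) = exp_decay \<theta> v * ennreal (exp (\<theta> * t))"
  by (cases v) (auto simp: exp_decay_def ennreal_mult[symmetric] exp_add[symmetric] algebra_simps ennreal_top_mult)

lemma exp_decay_min_le: "exp_decay \<theta> (min v w) \<le> exp_decay \<theta> v + exp_decay \<theta> w"
  by (cases "v \<le> w") (auto simp: min_def)

lemma exp_decay_less:
  assumes "0 < \<theta>" "exp_decay \<theta> v < ennreal (exp (- \<theta> * r))"
  shows "ereal r < v"
  using assms by (cases v) (auto simp: exp_decay_def ennreal_less_iff)

definition lyapunov :: "nat \<Rightarrow> real \<Rightarrow> real \<Rightarrow> (nat \<Rightarrow> ereal) \<Rightarrow> ennreal" where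
  "lyapunov M a \<theta> v = (\<Sum>j=1..M. ennreal (a ^ j) * exp_decay \<theta> (v j))"

lemma lyapunov_measurable [measurable]: "lyapunov M a \<theta> \<in> borel_measurable (ereal_vec M)"
proof -
  have [measurable]: "(\<lambda>v. v j) \<in> borel_measurable (ereal_vec M)" if "j \<in> {1..M}" for j
    using that by measurable
  show ?thesis unfolding lyapunov_def[abs_def] by measurable
qed

lemma lyapunov_finite:
  assumes "\<And>j. j \<in> {1..M} \<Longrightarrow> v j \<noteq> -\<infinity>"
  shows "lyapunov M a \<theta> v < \<infinity>"
  unfolding lyapunov_def using assms by (auto simp: exp_decay_def ennreal_mult_less_top)

text \<open>
  The exponential of a minimum is at most the sum of the two exponentials, so the weight
  \<open>a ^ j\<close> of coordinate \<open>j\<close> receives the contribution \<open>a ^ (j - 1)\<close> from its left neighbour. Geometric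
  weights with large \<open>a\<close> make that extra contribution a small fraction.
\<close>

lemma lyapunov_shift_min_le:
  assumes a: "0 < a"
  shows "lyapunov M a \<theta> (shift_min M v w) \<le>
    (\<Sum>j=1..M. ennreal ((1 + 1 / a) * a ^ j) * exp_decay \<theta> (v j) * ennreal (exp (\<theta> * w j)))"
proof -
  define z where "z j = exp_decay \<theta> (v j) * ennreal (exp (\<theta> * w j))" for j
  have "exp_decay \<theta> (shift_min M v w j) \<le> z j + (if j < M then z (Suc j) else 0)" if "j \<in> {1..M}" for j
    using that exp_decay_min_le[of \<theta> "v j - ereal (w j)" "v (Suc j) - ereal (w (Suc j))"]
    by (auto simp: shift_min_def exp_decay_diff z_def)
  then have "lyapunov M a \<theta> (shift_min M v w) \<le>
      (\<Sum>j=1..M. ennreal (a ^ j) * (z j + (if j < M then z (Suc j) else 0)))"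
    unfolding lyapunov_def by (intro sum_mono mult_left_mono) auto
  also have "\<dots> = (\<Sum>j=1..M. ennreal (a ^ j) * z j) + (\<Sum>j=1..M. ennreal (a ^ j) * (if j < M then z (Suc j) else 0))"
    by (simp add: distrib_left sum.distrib)
  also have "(\<Sum>j=1..M. ennreal (a ^ j) * (if j < M then z (Suc j) else 0)) =
      (\<Sum>j\<in>{1..<M}. ennreal (a ^ j) * z (Suc j))"
    by (rule sum.mono_neutral_cong_right) auto
  also have "\<dots> = (\<Sum>j\<in>{1..<M}. ennreal (a ^ Suc j / a) * z (Suc j))"
    using a by (intro sum.cong) auto
  also have "\<dots> = (\<Sum>j\<in>{Suc 1..<Suc M}. ennreal (a ^ j / a) * z j)"
    by (rule sum.shift_bounds_Suc_ivl[symmetric])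
  also have "\<dots> \<le> (\<Sum>j=1..M. ennreal (a ^ j / a) * z j)"
    by (intro sum_mono2) auto
  also have "(\<Sum>j=1..M. ennreal (a ^ j) * z j) + (\<Sum>j=1..M. ennreal (a ^ j / a) * z j) =
     (\<Sum>j=1..M. ennreal ((1 + 1 / a) * a ^ j) * z j)"
    unfolding sum.distrib[symmetric]
  proof (rule sum.cong)
    fix j
    have "ennreal ((1 + 1 / a) * a ^ j) = ennreal (a ^ j) + ennreal (a ^ j / a)"
      using a by (subst ennreal_plus[symmetric]) (auto simp: field_simps)
    then show "ennreal (a ^ j) * z j + ennreal (a ^ j / a) * z j = ennreal ((1 + 1 / a) * a ^ j) * z j"
      by (simp add: distrib_right)
  qed simp
  finally show ?thesis by (simp add: z_def mult.assoc add_left_mono)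
qed

text \<open>
  A small value of \<open>lyapunov\<close> forces every coordinate to be large, hence the vector into a
  given basic neighbourhood of \<open>infty_vec M\<close>. The point \<open>infty_vec M\<close> itself is not
  controlled by the filter and appears as a separate alternative.
\<close>

lemma eventually_to_infty_lyapunov:
  assumes "eventually P (to_infty M)" and \<theta>: "0 < \<theta>" and a: "1 \<le> a"
  obtains \<delta> :: real where "0 < \<delta>"
    "\<And>v. v \<in> {1..M} \<rightarrow>\<^sub>E UNIV \<Longrightarrow> lyapunov M a \<theta> v < ennreal \<delta> \<Longrightarrow> v = infty_vec M \<or> P v"
proof -
  obtain S where S: "open S" "infty_vec M \<in> S"
      "\<And>v. v \<in> S \<Longrightarrow> v \<in> {1..M} \<rightarrow>\<^sub>E UNIV \<Longrightarrow> v \<noteq> infty_vec M \<Longrightarrow> P v"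
    using assms(1) unfolding eventually_at_topological by blast
  have "openin (product_topology (\<lambda>i. euclidean) UNIV) S"
    using S(1) by (simp add: open_fun_def)
  from product_topology_open_contains_basis[OF this S(2)] obtain X where X:
    "infty_vec M \<in> (\<Pi>\<^sub>E i\<in>UNIV. X i)" "\<And>i. open (X i)" "(\<Pi>\<^sub>E i\<in>UNIV. X i) \<subseteq> S"
    by auto
  have "\<exists>B. {ereal B<..} \<subseteq> X j" if "j \<in> {1..M}" for j
  proof -
    have "infty_vec M j \<in> X j" using X(1) by (auto simp: PiE_iff simp del: restrict_apply)
    then have "\<infinity> \<in> X j" using that by simp
    with open_PInfty[OF X(2)] show ?thesis by blast
  qed
  then obtain B where B: "\<And>j. j \<in> {1..M} \<Longrightarrow> {ereal (B j)<..} \<subseteq> X j" by metis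
  obtain R where R: "\<And>j. j \<in> {1..M} \<Longrightarrow> B j \<le> R"
    using bdd_above_finite[of "B ` {1..M}"] unfolding bdd_above_def by (metis finite_atLeastAtMost finite_imageI imageI)
  show ?thesis
  proof
    show "0 < exp (- \<theta> * R)" by simp
    fix v assume v: "v \<in> {1..M} \<rightarrow>\<^sub>E UNIV" "lyapunov M a \<theta> v < ennreal (exp (- \<theta> * R))"
    have "v i \<in> X i" for i
    proof (cases "i \<in> {1..M}")
      case True
      have "exp_decay \<theta> (v i) \<le> ennreal (a ^ i) * exp_decay \<theta> (v i)"
        using one_le_power[OF a, of i] mult_right_mono[of 1 "ennreal (a ^ i)" "exp_decay \<theta> (v i)"] by simp
      also have "\<dots> \<le> lyapunov M a \<theta> v"
        unfolding lyapunov_def using True by (intro member_le_sum) auto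
      finally have "exp_decay \<theta> (v i) < ennreal (exp (- \<theta> * R))" using v(2) by simp
      then have "ereal R < v i" by (rule exp_decay_less[OF \<theta>])
      then have "ereal (B i) < v i" using R[OF True] by (meson ereal_less_eq(3) le_less_trans)
      then show ?thesis using B[OF True] by auto
    next
      case False
      then have "v i = infty_vec M i" using v(1) by (auto simp: PiE_iff extensional_def)
      then show ?thesis using X(1) by (auto simp: PiE_iff simp del: restrict_apply)
    qed
    then have "v \<in> S" using X(3) by auto
    then show "v = infty_vec M \<or> P v" using S(3) v(1) by blast
  qed
qed

text \<open>
  The moment bound is written so that the factor \<open>1 + 1 / a\<close> lost in \<open>lyapunov_shift_min_le\<close> leaves
  exactly the contraction rate \<open>r\<close>.
\<close>

locale contracting_tandem = tandem_steps +
  fixes a \<theta> r :: real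
  assumes a: "1 \<le> a" and \<theta>: "0 < \<theta>" and r: "0 \<le> r" "r < 1"
    and moments: "\<And>j. j \<in> {1..M} \<Longrightarrow> (\<integral>\<^sup>+u. ennreal (exp (\<theta> * u j)) \<partial>\<mu>) \<le> ennreal (r / (1 + 1 / a))"
begin

abbreviation L :: "(nat \<Rightarrow> ereal) \<Rightarrow> ennreal" where
  "L \<equiv> lyapunov M a \<theta>"

lemma step_lyapunov_le: "step L v \<le> ennreal r * L v"
proof -
  have meas: "(\<lambda>u. ennreal (exp (\<theta> * u j))) \<in> borel_measurable \<mu>" if "j \<in> {1..M}" for j
  proof -
    have [measurable]: "(\<lambda>u. u j) \<in> borel_measurable \<mu>"
      unfolding measurable_cong_sets[OF sets_\<mu> refl] by (rule measurable_component_singleton[OF that])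
    show ?thesis by measurable
  qed
  have "step L v \<le> (\<integral>\<^sup>+u. (\<Sum>j=1..M. ennreal ((1 + 1 / a) * a ^ j) * exp_decay \<theta> (v j) * ennreal (exp (\<theta> * u j))) \<partial>\<mu>)"
    unfolding step_def using a by (intro nn_integral_mono) (auto intro!: lyapunov_shift_min_le)
  also have "\<dots> = (\<Sum>j=1..M. ennreal ((1 + 1 / a) * a ^ j) * exp_decay \<theta> (v j) * (\<integral>\<^sup>+u. ennreal (exp (\<theta> * u j)) \<partial>\<mu>))"
    using meas by (subst nn_integral_sum) (auto intro!: sum.cong nn_integral_cmult)
  also have "\<dots> \<le> (\<Sum>j=1..M. ennreal ((1 + 1 / a) * a ^ j) * exp_decay \<theta> (v j) * ennreal (r / (1 + 1 / a)))"
    by (intro sum_mono mult_left_mono moments) auto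
  also have "\<dots> = (\<Sum>j=1..M. ennreal r * (ennreal (a ^ j) * exp_decay \<theta> (v j)))"
  proof (rule sum.cong)
    fix j
    have "(1 + 1 / a) * a ^ j * (r / (1 + 1 / a)) = r * a ^ j"
    proof -
      have "1 + 1 / a \<noteq> 0" using a by (smt (verit) divide_nonneg_nonneg)
      then show ?thesis by simp
    qed
    then have "ennreal ((1 + 1 / a) * a ^ j) * ennreal (r / (1 + 1 / a)) = ennreal r * ennreal (a ^ j)"
      using a r by (subst (1 2) ennreal_mult[symmetric]) auto
    then show "ennreal ((1 + 1 / a) * a ^ j) * exp_decay \<theta> (v j) * ennreal (r / (1 + 1 / a)) =
       ennreal r * (ennreal (a ^ j) * exp_decay \<theta> (v j))"
      by (metis mult.assoc mult.commute)
  qed simp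
  finally show ?thesis by (simp add: lyapunov_def sum_distrib_left)
qed

lemma steps_lyapunov_le: "v \<in> space (ereal_vec M) \<Longrightarrow> (step ^^ n) L v \<le> ennreal (r ^ n) * L v"
proof (induction n arbitrary: v)
  case (Suc n)
  have "step ((step ^^ n) L) v \<le> step (\<lambda>v. ennreal (r ^ n) * L v) v"
    by (intro step_mono Suc.IH)
  also have "\<dots> = ennreal (r ^ n) * step L v"
    by (rule step_cmult[OF lyapunov_measurable Suc.prems])
  also have "\<dots> \<le> ennreal (r ^ n) * (ennreal r * L v)"
    by (intro mult_left_mono step_lyapunov_le) auto
  also have "\<dots> = ennreal (r ^ Suc n) * L v"
    using r by (simp add: ennreal_mult mult_ac)
  finally show ?case by simp
qed simp

lemma remainder_vanishes:
  assumes "L v < \<infinity>"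
  shows "(\<lambda>n. ennreal C * (ennreal (r ^ n) * L v)) \<longlonglongrightarrow> 0"
proof -
  have "(\<lambda>n. ennreal (r ^ n)) \<longlonglongrightarrow> ennreal 0"
    using r by (intro tendsto_ennrealI LIMSEQ_realpow_zero)
  then have "(\<lambda>n. (ennreal C * L v) * ennreal (r ^ n)) \<longlonglongrightarrow> (ennreal C * L v) * ennreal 0"
    using assms by (intro ennreal_tendsto_cmult) (auto simp: ennreal_mult_less_top)
  then show ?thesis by (simp add: mult_ac)
qed

text \<open>
  Iterating \<open>f \<le> step f\<close> gives \<open>f \<le> (1 + \<epsilon>) * survival_prob n + C * r ^ n * L\<close> for every \<open>n\<close>.
\<close>

lemma subharmonic_le_eternal_prob:
  assumes f: "f \<in> borel_measurable (ereal_vec M)"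
    and sub: "\<And>v. v \<in> space (ereal_vec M) \<Longrightarrow> f v \<le> step f v"
    and near: "\<And>\<epsilon>. 0 < \<epsilon> \<Longrightarrow> \<exists>C. \<forall>v\<in>space (ereal_vec M). f v \<le> ennreal (1 + \<epsilon>) + ennreal C * L v"
    and v: "v \<in> space (ereal_vec M)" "L v < \<infinity>"
  shows "f v \<le> eternal_prob v"
proof -
  have *: "f v \<le> (step ^^ n) f v" if "v \<in> space (ereal_vec M)" for n v
    using that
  proof (induction n arbitrary: v)
    case (Suc n)
    have "f v \<le> step f v" by (rule sub[OF Suc.prems])
    also have "\<dots> \<le> step ((step ^^ n) f) v" by (intro step_mono Suc.IH)
    finally show ?case by simp
  qed simp
  have eps: "f v \<le> ennreal (1 + \<epsilon>) * eternal_prob v" if \<epsilon>: "0 < \<epsilon>" for \<epsilon>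
  proof -
    obtain C where C: "\<And>v. v \<in> space (ereal_vec M) \<Longrightarrow> f v \<le> ennreal (1 + \<epsilon>) + ennreal C * L v"
      using near[OF \<epsilon>] by blast
    have "f v \<le> ennreal (1 + \<epsilon>) * survival_prob n v + ennreal C * (ennreal (r ^ n) * L v)" for n
    proof -
      have "f v \<le> (step ^^ n) (\<lambda>v. ennreal (1 + \<epsilon>) * 1 + ennreal C * L v) v"
        by (rule order_trans[OF *[OF v(1), of n] steps_mono]) (use C v in auto)
      also have "\<dots> = (step ^^ n) (\<lambda>v. ennreal (1 + \<epsilon>) * 1) v + (step ^^ n) (\<lambda>v. ennreal C * L v) v"
        using v(1) by (intro steps_add) auto
      also have "\<dots> = ennreal (1 + \<epsilon>) * survival_prob n v + ennreal C * (step ^^ n) L v"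
        unfolding survival_prob_def using v(1)
        by (intro arg_cong2[where f = "(+)"] steps_cmult) auto
      also have "\<dots> \<le> ennreal (1 + \<epsilon>) * survival_prob n v + ennreal C * (ennreal (r ^ n) * L v)"
        by (intro add_left_mono mult_left_mono steps_lyapunov_le v) auto
      finally show ?thesis .
    qed
    moreover have "(\<lambda>n. ennreal (1 + \<epsilon>) * survival_prob n v + ennreal C * (ennreal (r ^ n) * L v))
        \<longlonglongrightarrow> ennreal (1 + \<epsilon>) * eternal_prob v + 0"
      unfolding eternal_prob_def
      by (intro tendsto_add remainder_vanishes v ennreal_tendsto_cmult LIMSEQ_INF decseq_survival_prob) auto
    ultimately show ?thesis
      by (simp add: LIMSEQ_le_const)
  qed
  have "((\<lambda>\<epsilon>::real. 1 + \<epsilon>) \<longlongrightarrow> 1 + 0) (at_right 0)"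
    by (intro tendsto_intros)
  then have "((\<lambda>\<epsilon>. ennreal (1 + \<epsilon>) * eternal_prob v) \<longlongrightarrow> ennreal (1 + 0) * eternal_prob v) (at_right 0)"
    using eternal_prob_le_1[OF v(1)]
    by (intro tendsto_mult_ennreal[OF tendsto_ennrealI tendsto_const]) (auto simp: top_unique)
  then have "f v \<le> ennreal (1 + 0) * eternal_prob v"
    by (rule tendsto_lowerbound) (auto intro: eventually_mono[OF eventually_at_right_less eps])
  then show ?thesis by simp
qed

text \<open>
  \<open>eternal_prob\<close> is a fixed point of \<open>step\<close>, so applying the operator \<open>n\<close> times to the assumed
  inequality changes only its right-hand side, to at most \<open>g + C * r ^ n * L\<close>.
\<close>

lemma eternal_prob_le_superharmonic:
  assumes g: "g \<in> borel_measurable (ereal_vec M)"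
    and super: "\<And>v. v \<in> space (ereal_vec M) \<Longrightarrow> step g v \<le> g v"
    and near: "\<And>\<epsilon>. 0 < \<epsilon> \<Longrightarrow>
      \<exists>C. \<forall>v\<in>space (ereal_vec M). ennreal (1 - \<epsilon>) * eternal_prob v \<le> g v + ennreal C * L v"
    and v: "v \<in> space (ereal_vec M)" "L v < \<infinity>"
  shows "eternal_prob v \<le> g v"
proof -
  have *: "(step ^^ n) g v \<le> g v" if "v \<in> space (ereal_vec M)" for n v
    using that
  proof (induction n arbitrary: v)
    case (Suc n)
    have "step ((step ^^ n) g) v \<le> step g v" by (intro step_mono Suc.IH)
    also have "\<dots> \<le> g v" by (rule super[OF Suc.prems])
    finally show ?case by simp
  qed simp
  have eps: "ennreal (1 - \<epsilon>) * eternal_prob v \<le> g v" if \<epsilon>: "0 < \<epsilon>" for \<epsilon>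
  proof -
    obtain C where C: "\<And>v. v \<in> space (ereal_vec M) \<Longrightarrow>
        ennreal (1 - \<epsilon>) * eternal_prob v \<le> g v + ennreal C * L v"
      using near[OF \<epsilon>] by blast
    have "ennreal (1 - \<epsilon>) * eternal_prob v \<le> g v + ennreal C * (ennreal (r ^ n) * L v)" for n
    proof -
      have "ennreal (1 - \<epsilon>) * eternal_prob v = (step ^^ n) (\<lambda>v. ennreal (1 - \<epsilon>) * eternal_prob v) v"
        using steps_cmult[OF eternal_prob_measurable v(1)] steps_eternal_prob[OF v(1)] by simp
      also have "\<dots> \<le> (step ^^ n) (\<lambda>v. g v + ennreal C * L v) v"
        by (rule steps_mono) (use C v in auto)
      also have "\<dots> = (step ^^ n) g v + (step ^^ n) (\<lambda>v. ennreal C * L v) v"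
        using v(1) g by (intro steps_add) auto
      also have "\<dots> = (step ^^ n) g v + ennreal C * (step ^^ n) L v"
        using v(1) by (simp add: steps_cmult)
      also have "\<dots> \<le> g v + ennreal C * (ennreal (r ^ n) * L v)"
        by (intro add_mono mult_left_mono steps_lyapunov_le v *) auto
      finally show ?thesis .
    qed
    moreover have "(\<lambda>n. g v + ennreal C * (ennreal (r ^ n) * L v)) \<longlonglongrightarrow> g v + 0"
      by (intro tendsto_add remainder_vanishes v tendsto_const)
    ultimately show ?thesis
      by (simp add: LIMSEQ_le_const)
  qed
  have "((\<lambda>\<epsilon>::real. 1 - \<epsilon>) \<longlongrightarrow> 1 - 0) (at_right 0)"
    by (intro tendsto_intros)
  then have "((\<lambda>\<epsilon>. ennreal (1 - \<epsilon>) * eternal_prob v) \<longlongrightarrow> ennreal (1 - 0) * eternal_prob v) (at_right 0)"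
    using eternal_prob_le_1[OF v(1)]
    by (intro tendsto_mult_ennreal[OF tendsto_ennrealI tendsto_const]) (auto simp: top_unique)
  then have "ennreal (1 - 0) * eternal_prob v \<le> g v"
    by (rule tendsto_upperbound) (auto intro: eventually_mono[OF eventually_at_right_less eps])
  then show ?thesis by simp
qed

end

context contracting_tandem
begin

text \<open>
  Comparison for \<open>\<gamma>\<close>. Where \<open>L\<close> is small the limit superior controls \<open>\<gamma>\<close>, elsewhere the global bound
  \<open>K\<close> is at most a multiple of \<open>L\<close>.
\<close>

lemma submartingale_bound:
  assumes meas: "\<gamma> \<in> borel_measurable (ereal_vec M)"
    and bound: "\<And>v. v \<in> {1..M} \<rightarrow>\<^sub>E UNIV \<Longrightarrow> \<gamma> v \<le> K"
    and infty: "\<gamma> (infty_vec M) = 1"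
    and limsup: "Limsup (to_infty M) (\<lambda>v. ereal (\<gamma> v)) = 1"
    and sub: "\<And>v. v \<in> {1..M} \<rightarrow>\<^sub>E UNIV \<Longrightarrow> 0 < \<gamma> v \<Longrightarrow> ennreal (\<gamma> v) \<le> step (\<lambda>v. ennreal (\<gamma> v)) v"
    and v: "v \<in> {1..M} \<rightarrow>\<^sub>E UNIV" "\<And>j. j \<in> {1..M} \<Longrightarrow> v j \<noteq> -\<infinity>"
  shows "ennreal (\<gamma> v) \<le> eternal_prob v"
proof (rule subharmonic_le_eternal_prob)
  show "(\<lambda>v. ennreal (\<gamma> v)) \<in> borel_measurable (ereal_vec M)" using meas by measurable
  show "ennreal (\<gamma> v) \<le> step (\<lambda>v. ennreal (\<gamma> v)) v" if "v \<in> space (ereal_vec M)" for v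
    using sub[of v] that by (cases "0 < \<gamma> v") (auto simp: space_ereal_vec ennreal_neg)
  show "v \<in> space (ereal_vec M)" using v by (simp add: space_ereal_vec)
  show "L v < \<infinity>" using v(2) by (rule lyapunov_finite)
  fix \<epsilon> :: real assume \<epsilon>: "0 < \<epsilon>"
  have "eventually (\<lambda>v. \<gamma> v < 1 + \<epsilon>) (to_infty M)"
    using Limsup_lessD[of "to_infty M" "\<lambda>v. ereal (\<gamma> v)" "ereal (1 + \<epsilon>)"] limsup \<epsilon> by (simp add: one_ereal_def)
  then obtain \<delta> where \<delta>: "0 < \<delta>"
      "\<And>v. v \<in> {1..M} \<rightarrow>\<^sub>E UNIV \<Longrightarrow> L v < ennreal \<delta> \<Longrightarrow> v = infty_vec M \<or> \<gamma> v < 1 + \<epsilon>"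
    using eventually_to_infty_lyapunov[OF _ \<theta> a] by metis
  have "ennreal (\<gamma> v) \<le> ennreal (1 + \<epsilon>) + ennreal (max K 0 / \<delta>) * L v" if "v \<in> {1..M} \<rightarrow>\<^sub>E UNIV" for v
  proof (cases "L v < ennreal \<delta>")
    case True
    then have "\<gamma> v \<le> 1 + \<epsilon>" using \<delta>(2)[OF that] infty \<epsilon> by auto
    then have "ennreal (\<gamma> v) \<le> ennreal (1 + \<epsilon>)" by (rule ennreal_leI)
    then show ?thesis by (intro add_increasing2) auto
  next
    case False
    have "ennreal (\<gamma> v) \<le> ennreal (max K 0 / \<delta> * \<delta>)"
      using bound[OF that] \<delta>(1) by (intro ennreal_leI) auto
    also have "\<dots> = ennreal (max K 0 / \<delta>) * ennreal \<delta>" using \<delta>(1) by (intro ennreal_mult) auto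
    also have "\<dots> \<le> ennreal (max K 0 / \<delta>) * L v" using False by (intro mult_left_mono) auto
    finally show ?thesis by (intro add_increasing) auto
  qed
  then show "\<exists>C. \<forall>v\<in>space (ereal_vec M). ennreal (\<gamma> v) \<le> ennreal (1 + \<epsilon>) + ennreal C * L v"
    by (auto simp: space_ereal_vec)
qed

text \<open>
  Comparison for \<open>\<eta>\<close>. The supermartingale inequality is available only where \<open>eternal_prob\<close> is
  positive. From a point where it is 0 the walk almost surely does not survive a step into the
  positive region, so \<open>\<eta>\<close> may be replaced by 0 there.
\<close>

lemma supermartingale_bound:
  assumes meas: "\<eta> \<in> borel_measurable (ereal_vec M)"
    and infty: "\<eta> (infty_vec M) = 1"
    and liminf: "Liminf (to_infty M) (\<lambda>v. ereal (\<eta> v)) = 1"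
    and super: "\<And>v. v \<in> {1..M} \<rightarrow>\<^sub>E UNIV \<Longrightarrow> eternal_prob v \<noteq> 0 \<Longrightarrow> step (\<lambda>v. ennreal (\<eta> v)) v \<le> ennreal (\<eta> v)"
    and v: "v \<in> {1..M} \<rightarrow>\<^sub>E UNIV" "\<And>j. j \<in> {1..M} \<Longrightarrow> v j \<noteq> -\<infinity>"
  shows "eternal_prob v \<le> ennreal (\<eta> v)"
proof -
  define g where "g v = (if eternal_prob v = 0 then 0 else ennreal (\<eta> v))" for v
  have g_meas: "g \<in> borel_measurable (ereal_vec M)"
    unfolding g_def[abs_def] using meas by measurable
  have "eternal_prob v \<le> g v"
  proof (rule eternal_prob_le_superharmonic[OF g_meas])
    show "v \<in> space (ereal_vec M)" using v by (simp add: space_ereal_vec)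
    show "L v < \<infinity>" using v(2) by (rule lyapunov_finite)
    show "step g v \<le> g v" if v: "v \<in> space (ereal_vec M)" for v
    proof (cases "eternal_prob v = 0")
      case True
      then have "step eternal_prob v = 0" by (simp add: step_eternal_prob[OF v])
      then have "AE u in \<mu>. (if ereal (u 1) \<le> v 1 then eternal_prob (shift_min M v u) else 0) = 0"
        unfolding step_def
        by (subst (asm) nn_integral_0_iff_AE) (use step_integrand_measurable'[OF eternal_prob_measurable v] in auto)
      then have "AE u in \<mu>. (if ereal (u 1) \<le> v 1 then g (shift_min M v u) else 0) = 0"
        by eventually_elim (auto simp: g_def split: if_splits)
      then have "step g v = 0" unfolding step_def by (subst nn_integral_cong_AE) auto
      then show ?thesis by simp
    next
      case False
      have "step g v \<le> step (\<lambda>v. ennreal (\<eta> v)) v" by (intro step_mono) (simp add: g_def)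
      also have "\<dots> \<le> g v" using super[of v] False v by (simp add: g_def space_ereal_vec)
      finally show ?thesis .
    qed
    fix \<epsilon> :: real assume \<epsilon>: "0 < \<epsilon>"
    have "eventually (\<lambda>v. 1 - \<epsilon> < \<eta> v) (to_infty M)"
      using less_LiminfD[of "ereal (1 - \<epsilon>)" "to_infty M" "\<lambda>v. ereal (\<eta> v)"] liminf \<epsilon> by (simp add: one_ereal_def)
    then obtain \<delta> where \<delta>: "0 < \<delta>"
        "\<And>v. v \<in> {1..M} \<rightarrow>\<^sub>E UNIV \<Longrightarrow> L v < ennreal \<delta> \<Longrightarrow> v = infty_vec M \<or> 1 - \<epsilon> < \<eta> v"
      using eventually_to_infty_lyapunov[OF _ \<theta> a] by metis
    have "ennreal (1 - \<epsilon>) * eternal_prob v \<le> g v + ennreal (1 / \<delta>) * L v"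
      if v: "v \<in> space (ereal_vec M)" for v
    proof (cases "L v < ennreal \<delta>")
      case True
      then have "1 - \<epsilon> \<le> \<eta> v" using \<delta>(2)[of v] v infty \<epsilon> by (auto simp: space_ereal_vec)
      then have "ennreal (1 - \<epsilon>) * eternal_prob v \<le> g v"
        using mult_mono[OF ennreal_leI eternal_prob_le_1[OF v], of "1 - \<epsilon>" "\<eta> v"] by (simp add: g_def)
      then show ?thesis by (intro add_increasing2) auto
    next
      case False
      have "ennreal (1 - \<epsilon>) * eternal_prob v \<le> ennreal 1 * 1"
        using \<epsilon> eternal_prob_le_1[OF v] by (intro mult_mono ennreal_leI) auto
      also have "\<dots> = ennreal (1 / \<delta>) * ennreal \<delta>"
        using \<delta>(1) by (subst ennreal_mult[symmetric]) auto
      also have "\<dots> \<le> ennreal (1 / \<delta>) * L v" using False by (intro mult_left_mono) auto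
      finally show ?thesis by (intro add_increasing) auto
    qed
    then show "\<exists>C. \<forall>v\<in>space (ereal_vec M). ennreal (1 - \<epsilon>) * eternal_prob v \<le> g v + ennreal C * L v"
      by blast
  qed
  also have "g v \<le> ennreal (\<eta> v)" by (simp add: g_def)
  finally show ?thesis .
qed

end

section \<open>Exponential moments below one\<close>

lemma abs_exp_minus_1_le: "\<bar>exp t - 1\<bar> \<le> \<bar>t\<bar> * exp \<bar>t\<bar>" for t :: real
proof (cases "0 \<le> t")
  case True
  have "(1 - t) * exp t \<le> exp (- t) * exp t"
    using exp_ge_add_one_self[of "- t"] by (intro mult_right_mono) auto
  also have "\<dots> = 1" by (simp add: exp_minus)
  finally show ?thesis using True by (simp add: algebra_simps)
next
  case False
  have "1 - exp t \<le> - t" using exp_ge_add_one_self[of t] by linarith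
  also have "\<dots> \<le> - t * exp (- t)" using False by (simp add: mult_le_cancel_left1)
  finally show ?thesis using False by simp
qed

lemma (in prob_space) integrable_of_exp_integrable:
  fixes Y :: "'a \<Rightarrow> real"
  assumes "random_variable borel Y" "AE \<omega> in M. 0 \<le> Y \<omega>" "0 < \<theta>" "integrable M (\<lambda>\<omega>. exp (\<theta> * Y \<omega>))"
  shows "integrable M Y"
proof (rule Bochner_Integration.integrable_bound)
  show "integrable M (\<lambda>\<omega>. exp (\<theta> * Y \<omega>) / \<theta>)" using assms(4) by simp
  show "AE \<omega> in M. norm (Y \<omega>) \<le> norm (exp (\<theta> * Y \<omega>) / \<theta>)"
    using assms(2)
  proof eventually_elim
    case (elim \<omega>)
    have "\<theta> * Y \<omega> \<le> exp (\<theta> * Y \<omega>)" using exp_ge_add_one_self[of "\<theta> * Y \<omega>"] by linarith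
    then show ?case using elim assms(3) by (simp add: field_simps)
  qed
qed (use assms in simp)

lemma (in prob_space) truncation_level:
  fixes X :: "'a \<Rightarrow> real"
  assumes X: "random_variable borel X" "AE \<omega> in M. 0 \<le> X \<omega>"
    and less: "c < (\<integral>\<^sup>+\<omega>. ennreal (X \<omega>) \<partial>M)"
  obtains B :: real where "0 \<le> B" "c < (\<integral>\<^sup>+\<omega>. ennreal (min (X \<omega>) B) \<partial>M)"
proof -
  note [measurable] = X(1)
  have "(\<lambda>n. \<integral>\<^sup>+\<omega>. ennreal (min (X \<omega>) (real n)) \<partial>M) \<longlonglongrightarrow> (\<integral>\<^sup>+\<omega>. ennreal (X \<omega>) \<partial>M)"
  proof (rule nn_integral_LIMSEQ)
    show "incseq (\<lambda>n \<omega>. ennreal (min (X \<omega>) (real n)))"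
      by (auto simp: incseq_def le_fun_def intro!: ennreal_leI)
    fix \<omega>
    have "\<forall>\<^sub>F n in sequentially. X \<omega> \<le> real n"
      using filterlim_real_sequentially unfolding filterlim_at_top by blast
    then have "\<forall>\<^sub>F n in sequentially. ennreal (X \<omega>) = ennreal (min (X \<omega>) (real n))"
      by eventually_elim simp
    then show "(\<lambda>n. ennreal (min (X \<omega>) (real n))) \<longlonglongrightarrow> ennreal (X \<omega>)"
      by (rule Lim_transform_eventually[OF tendsto_const])
  qed simp
  from order_tendstoD(1)[OF this less] obtain n where "c < (\<integral>\<^sup>+\<omega>. ennreal (min (X \<omega>) (real n)) \<partial>M)"
    by (auto simp: eventually_sequentially)
  then show ?thesis by (intro that[of "real n"]) auto
qed

text \<open>
  The derivative of \<open>t \<mapsto> E[exp (t (Y - X))]\<close> at 0 is the negative drift. Since \<open>X\<close> may have infinite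
  mean, it is first truncated at a level that keeps the drift negative; this only increases \<open>Y - X\<close>.
  The difference quotients at \<open>t = 1 / n\<close> are then dominated by a multiple of
  \<open>exp (\<theta> * Y)\<close>.
\<close>

lemma (in prob_space) exponential_moment_less_1:
  fixes X Y :: "'a \<Rightarrow> real"
  assumes X: "random_variable borel X" "AE \<omega> in M. 0 \<le> X \<omega>"
    and Y: "random_variable borel Y" "AE \<omega> in M. 0 \<le> Y \<omega>"
    and \<theta>: "0 < \<theta>" "integrable M (\<lambda>\<omega>. exp (\<theta> * Y \<omega>))"
    and less: "(\<integral>\<^sup>+\<omega>. ennreal (Y \<omega>) \<partial>M) < (\<integral>\<^sup>+\<omega>. ennreal (X \<omega>) \<partial>M)"
  shows "\<forall>\<^sub>F n in sequentially. (\<integral>\<^sup>+\<omega>. ennreal (exp ((Y \<omega> - X \<omega>) / real n)) \<partial>M) < 1"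
proof -
  note [measurable] = X(1) Y(1)
  obtain B where B: "0 \<le> B" "(\<integral>\<^sup>+\<omega>. ennreal (Y \<omega>) \<partial>M) < (\<integral>\<^sup>+\<omega>. ennreal (min (X \<omega>) B) \<partial>M)"
    using truncation_level[OF X less] .
  define D where "D \<omega> = Y \<omega> - min (X \<omega>) B" for \<omega>
  have [measurable]: "D \<in> borel_measurable M" unfolding D_def by measurable
  have int_Y: "integrable M Y" by (rule integrable_of_exp_integrable[OF Y \<theta>])
  have int_B: "integrable M (\<lambda>\<omega>. min (X \<omega>) B)"
    by (rule integrable_const_bound[where B = B]) (use X(2) B(1) in auto)
  have drift: "(\<integral>\<omega>. D \<omega> \<partial>M) < 0"
  proof -
    have "(\<integral>\<^sup>+\<omega>. ennreal (Y \<omega>) \<partial>M) = ennreal (\<integral>\<omega>. Y \<omega> \<partial>M)"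
      by (rule nn_integral_eq_integral[OF int_Y Y(2)])
    moreover have "(\<integral>\<^sup>+\<omega>. ennreal (min (X \<omega>) B) \<partial>M) = ennreal (\<integral>\<omega>. min (X \<omega>) B \<partial>M)"
      by (rule nn_integral_eq_integral[OF int_B]) (use X(2) B(1) in auto)
    moreover have "0 \<le> (\<integral>\<omega>. Y \<omega> \<partial>M)" using Y(2) by (rule integral_nonneg_AE)
    ultimately have "(\<integral>\<omega>. Y \<omega> \<partial>M) < (\<integral>\<omega>. min (X \<omega>) B \<partial>M)" using B(2) by (simp add: ennreal_less_iff)
    then show ?thesis unfolding D_def using int_Y int_B by simp
  qed
  \<comment> \<open>For n at least 2 / \<theta> the exponential in the difference quotient costs at most half of the
    exponent \<theta>; the other half absorbs the linear factor.\<close>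
  define N where "N = nat \<lceil>2 / \<theta>\<rceil> + 1"
  have N: "2 / \<theta> \<le> real (n + N)" "0 < real (n + N)" for n
    unfolding N_def by linarith+
  define g where "g n \<omega> = real (n + N) * (exp (D \<omega> / real (n + N)) - 1)" for n \<omega>
  have [measurable]: "g n \<in> borel_measurable M" for n unfolding g_def[abs_def] by measurable
  define w where "w \<omega> = 2 / \<theta> * exp (\<theta> * B) * exp (\<theta> * Y \<omega>)" for \<omega>
  have w: "integrable M w" unfolding w_def[abs_def] using \<theta>(2) by simp
  have lim: "AE \<omega> in M. (\<lambda>n. g n \<omega>) \<longlonglongrightarrow> D \<omega>"
  proof (rule AE_I2)
    fix \<omega> show "(\<lambda>n. g n \<omega>) \<longlonglongrightarrow> D \<omega>" unfolding g_def by real_asymp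
  qed
  have bound: "AE \<omega> in M. norm (g n \<omega>) \<le> w \<omega>" for n
    using X(2) Y(2)
  proof eventually_elim
    case (elim \<omega>)
    let ?n = "real (n + N)" and ?b = "Y \<omega> + B"
    have b: "\<bar>D \<omega>\<bar> \<le> ?b" using elim B(1) by (auto simp: D_def)
    have "norm (g n \<omega>) = ?n * \<bar>exp (D \<omega> / ?n) - 1\<bar>" using N(2)[of n] by (simp add: g_def abs_mult)
    also have "\<dots> \<le> ?n * (\<bar>D \<omega> / ?n\<bar> * exp \<bar>D \<omega> / ?n\<bar>)"
      using N(2)[of n] by (intro mult_left_mono abs_exp_minus_1_le) auto
    also have "\<dots> = \<bar>D \<omega>\<bar> * exp (\<bar>D \<omega>\<bar> / ?n)" using N(2)[of n] by (simp add: abs_divide)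
    also have "\<dots> \<le> ?b * exp (\<theta> / 2 * ?b)"
    proof (intro mult_mono)
      have "\<bar>D \<omega>\<bar> / ?n \<le> ?b / (2 / \<theta>)"
        using N[of n] b \<theta>(1) by (intro frac_le) auto
      then show "exp (\<bar>D \<omega>\<bar> / ?n) \<le> exp (\<theta> / 2 * ?b)" by (simp add: mult.commute)
    qed (use b in auto)
    also have "\<dots> \<le> (2 / \<theta> * exp (\<theta> / 2 * ?b)) * exp (\<theta> / 2 * ?b)"
    proof (intro mult_right_mono)
      have "\<theta> / 2 * ?b \<le> exp (\<theta> / 2 * ?b)" using exp_ge_add_one_self[of "\<theta> / 2 * ?b"] by linarith
      then show "?b \<le> 2 / \<theta> * exp (\<theta> / 2 * ?b)" using \<theta>(1) by (simp add: field_simps)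
    qed simp
    also have "\<dots> = w \<omega>" by (simp add: w_def mult.assoc exp_add[symmetric] algebra_simps)
    finally show ?case .
  qed
  have "(\<lambda>n. \<integral>\<omega>. g n \<omega> \<partial>M) \<longlonglongrightarrow> (\<integral>\<omega>. D \<omega> \<partial>M)"
    by (rule integral_dominated_convergence[OF _ _ w lim bound]) auto
  then have "\<forall>\<^sub>F n in sequentially. (\<integral>\<omega>. g n \<omega> \<partial>M) < 0"
    using drift by (rule order_tendstoD)
  then have "\<forall>\<^sub>F n in sequentially. (\<integral>\<^sup>+\<omega>. ennreal (exp ((Y \<omega> - X \<omega>) / real (n + N))) \<partial>M) < 1"
  proof eventually_elim
    case (elim n)
    have int_g: "integrable M (g n)"
      by (rule integrable_dominated_convergence2[OF _ _ w lim bound]) auto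
    have eq: "exp (D \<omega> / real (n + N)) = g n \<omega> / real (n + N) + 1" for \<omega>
      using N(2)[of n] by (simp add: g_def)
    have int_exp: "integrable M (\<lambda>\<omega>. exp (D \<omega> / real (n + N)))"
      unfolding eq using int_g by simp
    have "(\<integral>\<^sup>+\<omega>. ennreal (exp ((Y \<omega> - X \<omega>) / real (n + N))) \<partial>M) \<le>
        (\<integral>\<^sup>+\<omega>. ennreal (exp (D \<omega> / real (n + N))) \<partial>M)"
      using N(2)[of n] by (intro nn_integral_mono ennreal_leI) (auto simp: D_def intro!: divide_right_mono)
    also have "\<dots> = ennreal (\<integral>\<omega>. exp (D \<omega> / real (n + N)) \<partial>M)"
      by (rule nn_integral_eq_integral[OF int_exp]) simp
    also have "\<dots> = ennreal ((\<integral>\<omega>. g n \<omega> \<partial>M) / real (n + N) + 1)"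
      unfolding eq using int_g by (simp add: prob_space)
    also have "\<dots> < ennreal 1"
      using elim N(2)[of n] by (intro ennreal_lessI) (auto simp: divide_neg_pos)
    finally show ?case by simp
  qed
  then show ?thesis
    by (subst (asm) eventually_sequentially_seg[of "\<lambda>n. (\<integral>\<^sup>+\<omega>. ennreal (exp ((Y \<omega> - X \<omega>) / real n)) \<partial>M) < 1"])
qed

lemma (in prob_space) common_exponential_moment:
  fixes X :: "'a \<Rightarrow> real" and Y :: "nat \<Rightarrow> 'a \<Rightarrow> real"
  assumes X: "random_variable borel X" "AE \<omega> in M. 0 \<le> X \<omega>"
    and Y: "\<And>j. j \<in> {1..m} \<Longrightarrow> random_variable borel (Y j)" "\<And>j. j \<in> {1..m} \<Longrightarrow> AE \<omega> in M. 0 \<le> Y j \<omega>"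
    and light: "\<And>j. j \<in> {1..m} \<Longrightarrow> \<exists>\<theta>>0. integrable M (\<lambda>\<omega>. exp (\<theta> * Y j \<omega>))"
    and less: "\<And>j. j \<in> {1..m} \<Longrightarrow> (\<integral>\<^sup>+\<omega>. ennreal (Y j \<omega>) \<partial>M) < (\<integral>\<^sup>+\<omega>. ennreal (X \<omega>) \<partial>M)"
  obtains \<theta> \<rho> :: real where "0 < \<theta>" "0 \<le> \<rho>" "\<rho> < 1"
    "\<And>j. j \<in> {1..m} \<Longrightarrow> (\<integral>\<^sup>+\<omega>. ennreal (exp (\<theta> * (Y j \<omega> - X \<omega>))) \<partial>M) \<le> ennreal \<rho>"
proof -
  have "\<forall>\<^sub>F n in sequentially. \<forall>j\<in>{1..m}. (\<integral>\<^sup>+\<omega>. ennreal (exp ((Y j \<omega> - X \<omega>) / real n)) \<partial>M) < 1"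
  proof (intro eventually_ball_finite ballI)
    fix j assume j: "j \<in> {1..m}"
    obtain \<theta> where "0 < \<theta>" "integrable M (\<lambda>\<omega>. exp (\<theta> * Y j \<omega>))" using light[OF j] by blast
    then show "\<forall>\<^sub>F n in sequentially. (\<integral>\<^sup>+\<omega>. ennreal (exp ((Y j \<omega> - X \<omega>) / real n)) \<partial>M) < 1"
      by (rule exponential_moment_less_1[OF X Y(1)[OF j] Y(2)[OF j] _ _ less[OF j]])
  qed simp
  then have "\<forall>\<^sub>F n in sequentially. 0 < n \<and>
      (\<forall>j\<in>{1..m}. (\<integral>\<^sup>+\<omega>. ennreal (exp ((Y j \<omega> - X \<omega>) / real n)) \<partial>M) < 1)"
    using eventually_gt_at_top[of 0] by eventually_elim simp
  then obtain n where n: "0 < n"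
      "\<And>j. j \<in> {1..m} \<Longrightarrow> (\<integral>\<^sup>+\<omega>. ennreal (exp ((Y j \<omega> - X \<omega>) / real n)) \<partial>M) < 1"
    by (auto simp: eventually_sequentially)
  define q where "q j = (\<integral>\<^sup>+\<omega>. ennreal (exp ((Y j \<omega> - X \<omega>) / real n)) \<partial>M)" for j
  define \<rho> where "\<rho> = Max (insert 0 ((\<lambda>j. enn2real (q j)) ` {1..m}))"
  have q: "q j = ennreal (enn2real (q j))" "enn2real (q j) < 1" if "j \<in> {1..m}" for j
  proof -
    have "q j < 1" using n(2)[OF that] by (simp add: q_def)
    then show "q j = ennreal (enn2real (q j))"
      using ennreal_enn2real[OF less_trans[OF _ ennreal_one_less_top]] by simp
    with \<open>q j < 1\<close> show "enn2real (q j) < 1" by (metis ennreal_1 ennreal_less_iff enn2real_nonneg)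
  qed
  show ?thesis
  proof (rule that)
    show "0 < 1 / real n" using n(1) by simp
    show "0 \<le> \<rho>" by (simp add: \<rho>_def)
    show "\<rho> < 1" using q(2) by (auto simp: \<rho>_def)
    fix j assume j: "j \<in> {1..m}"
    have "enn2real (q j) \<le> \<rho>" unfolding \<rho>_def using j by (intro Max_ge) auto
    then have "q j \<le> ennreal \<rho>" by (subst q(1)[OF j]) (rule ennreal_leI)
    then show "(\<integral>\<^sup>+\<omega>. ennreal (exp (1 / real n * (Y j \<omega> - X \<omega>))) \<partial>M) \<le> ennreal \<rho>"
      by (simp add: q_def)
  qed
qed

section \<open>Laws of independent families and limits of distribution functions\<close>

text \<open>
  Restriction to the disjoint singletons \<open>{f j}\<close>.
\<close>

lemma (in prob_space) indep_vars_reindex: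
  assumes "indep_vars N X I" "inj_on f J" "f ` J \<subseteq> I"
  shows "indep_vars (\<lambda>j. N (f j)) (\<lambda>j. X (f j)) J"
proof -
  have "indep_vars (\<lambda>j. PiM {f j} N) (\<lambda>j \<omega>. restrict (\<lambda>i. X i \<omega>) {f j}) J"
    using assms by (intro indep_vars_restrict[OF assms(1)])
      (auto simp: disjoint_family_on_def inj_on_def)
  then have "indep_vars (\<lambda>j. N (f j)) (\<lambda>j \<omega>. (\<lambda>r. r (f j)) (restrict (\<lambda>i. X i \<omega>) {f j})) J"
    by (rule indep_vars_compose2) auto
  then show ?thesis by simp
qed

lemma (in prob_space) distr_indep_family:
  assumes "indep_vars (\<lambda>_. N) X I" "I \<noteq> {}" "\<And>i. i \<in> I \<Longrightarrow> distr M N (X i) = D i"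
  shows "distr M (\<Pi>\<^sub>M i\<in>I. N) (\<lambda>\<omega>. \<lambda>i\<in>I. X i \<omega>) = (\<Pi>\<^sub>M i\<in>I. D i)"
proof -
  have "distr M (\<Pi>\<^sub>M i\<in>I. N) (\<lambda>\<omega>. \<lambda>i\<in>I. X i \<omega>) = (\<Pi>\<^sub>M i\<in>I. distr M N (X i))"
    using assms(1,2) by (subst indep_vars_iff_distr_eq_PiM'[symmetric]) (auto simp: indep_vars_def)
  also have "\<dots> = (\<Pi>\<^sub>M i\<in>I. D i)" by (intro PiM_cong) (auto simp: assms(3))
  finally show ?thesis .
qed

lemma (in prob_space) distr_iid_sequence:
  fixes U :: "nat \<Rightarrow> 'a \<Rightarrow> 'b"
  assumes "indep_vars (\<lambda>_. N) U UNIV" "\<And>k. distr M N (U k) = D"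
  shows "distr M (\<Pi>\<^sub>M k\<in>UNIV. N) (\<lambda>\<omega> k. U k \<omega>) = (\<Pi>\<^sub>M k\<in>UNIV. D)"
  using distr_indep_family[OF assms(1), of "\<lambda>_. D"] assms(2) by (simp add: restrict_UNIV)

text \<open>
  The law of the vector of increments depends only on the marginals; this identifies the
  steps read off the network with copies of \<open>V\<close>.
\<close>

lemma (in prob_space) distr_increments:
  fixes F :: "nat \<Rightarrow> 'a \<Rightarrow> real"
  assumes "indep_vars (\<lambda>_. borel) F {0..m}" "\<And>j. j \<in> {0..m} \<Longrightarrow> distr M borel (F j) = D j"
  shows "distr M (\<Pi>\<^sub>M j\<in>{1..m}. borel) (\<lambda>\<omega>. \<lambda>j\<in>{1..m}. F j \<omega> - F 0 \<omega>) =
    distr (\<Pi>\<^sub>M j\<in>{0..m}. D j) (\<Pi>\<^sub>M j\<in>{1..m}. borel) (\<lambda>z. \<lambda>j\<in>{1..m}. z j - z 0)"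
proof -
  have F: "(\<lambda>\<omega>. \<lambda>j\<in>{0..m}. F j \<omega>) \<in> M \<rightarrow>\<^sub>M (\<Pi>\<^sub>M j\<in>{0..m}. borel)"
    using assms(1) by (intro measurable_restrict) (auto simp: indep_vars_def)
  have diff: "(\<lambda>z. \<lambda>j\<in>{1..m}. z j - z 0) \<in> (\<Pi>\<^sub>M j\<in>{0..m}. borel) \<rightarrow>\<^sub>M (\<Pi>\<^sub>M j\<in>{1..m}. (borel :: real measure))"
    by (intro measurable_restrict borel_measurable_diff measurable_component_singleton) auto
  have "distr (\<Pi>\<^sub>M j\<in>{0..m}. D j) (\<Pi>\<^sub>M j\<in>{1..m}. borel) (\<lambda>z. \<lambda>j\<in>{1..m}. z j - z 0) =
    distr (distr M (\<Pi>\<^sub>M j\<in>{0..m}. borel) (\<lambda>\<omega>. \<lambda>j\<in>{0..m}. F j \<omega>)) (\<Pi>\<^sub>M j\<in>{1..m}. borel)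
      (\<lambda>z. \<lambda>j\<in>{1..m}. z j - z 0)"
    by (subst distr_indep_family[OF assms(1), of D]) (use assms in auto)
  also have "\<dots> = distr M (\<Pi>\<^sub>M j\<in>{1..m}. borel) (\<lambda>\<omega>. \<lambda>j\<in>{1..m}. F j \<omega> - F 0 \<omega>)"
    by (subst distr_distr[OF diff F]) (auto intro!: distr_cong)
  finally show ?thesis ..
qed

text \<open>
  Weak convergence gives convergence at continuity points, which are dense. Monotonicity in \<open>n\<close> and
  right continuity carry it to every point: an infimum of right-continuous nondecreasing functions is
  again right-continuous.
\<close>

lemma cdf_tendsto_of_decreasing_cdfs:
  fixes \<mu> :: "nat \<Rightarrow> real measure"
  assumes "\<And>n. real_distribution (\<mu> n)" "real_distribution \<nu>" "weak_conv_m \<mu> \<nu>"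
    and dec: "\<And>y. x \<le> y \<Longrightarrow> decseq (\<lambda>n. cdf (\<mu> n) y)"
  shows "(\<lambda>n. cdf (\<mu> n) x) \<longlonglongrightarrow> cdf \<nu> x"
proof -
  interpret N: real_distribution \<nu> by fact
  have continuity_point: "\<exists>y. x < y \<and> y < z \<and> (\<lambda>n. cdf (\<mu> n) y) \<longlonglongrightarrow> cdf \<nu> y" if z: "x < z" for z
  proof -
    obtain y where y: "y \<in> {x<..<z}" "y \<notin> {t. measure \<nu> {t} > 0}"
      using real_interval_avoid_countable_set[OF z N.countable_atoms] by blast
    then have "measure \<nu> {y} = 0" using measure_nonneg[of \<nu> "{y}"] by (simp add: not_less antisym)
    then have "isCont (cdf \<nu>) y" by (simp add: N.isCont_cdf)
    then show ?thesis using assms(3) y(1) by (auto simp: weak_conv_m_def weak_conv_def)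
  qed
  have right_limit: "(cdf \<rho> \<longlongrightarrow> cdf \<rho> x) (at_right x)" if "real_distribution \<rho>" for \<rho>
  proof -
    interpret R: real_distribution \<rho> by fact
    show ?thesis using R.cdf_is_right_cont by (simp add: continuous_within)
  qed
  have lower: "cdf \<nu> x \<le> cdf (\<mu> n) x" for n
  proof (rule tendsto_lowerbound[OF right_limit[OF assms(1)]])
    interpret R: real_distribution "\<mu> n" by fact
    have "cdf \<nu> x \<le> cdf (\<mu> n) z" if z: "x < z" for z
    proof -
      obtain y where y: "x < y" "y < z" "(\<lambda>n. cdf (\<mu> n) y) \<longlonglongrightarrow> cdf \<nu> y"
        using continuity_point[OF z] by blast
      have "cdf \<nu> x \<le> cdf \<nu> y" by (rule N.cdf_nondecreasing) (use y in simp)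
      also have "\<dots> \<le> cdf (\<mu> n) y" using y by (intro decseq_ge[OF dec]) auto
      also have "\<dots> \<le> cdf (\<mu> n) z" by (rule R.cdf_nondecreasing) (use y in simp)
      finally show ?thesis .
    qed
    then show "\<forall>\<^sub>F z in at_right x. cdf \<nu> x \<le> cdf (\<mu> n) z"
      by (intro eventually_mono[OF eventually_at_right_less])
  qed simp
  then obtain l where l: "(\<lambda>n. cdf (\<mu> n) x) \<longlonglongrightarrow> l"
    using decseq_convergent[OF dec[OF order_refl], of "cdf \<nu> x"] by blast
  have "l \<le> cdf \<nu> z" if z: "x < z" for z
  proof -
    obtain y where y: "x < y" "y < z" "(\<lambda>n. cdf (\<mu> n) y) \<longlonglongrightarrow> cdf \<nu> y"
      using continuity_point[OF z] by blast
    have "cdf (\<mu> n) x \<le> cdf (\<mu> n) y" for n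
    proof -
      interpret R: real_distribution "\<mu> n" by fact
      show ?thesis using y by (intro R.cdf_nondecreasing) simp
    qed
    then have "l \<le> cdf \<nu> y" by (intro LIMSEQ_le[OF l y(3)]) auto
    also have "\<dots> \<le> cdf \<nu> z" by (rule N.cdf_nondecreasing) (use y in simp)
    finally show ?thesis .
  qed
  then have "l \<le> cdf \<nu> x"
    by (intro tendsto_lowerbound[OF right_limit[OF assms(2)]])
       (auto intro: eventually_mono[OF eventually_at_right_less])
  moreover have "cdf \<nu> x \<le> l" using lower by (intro LIMSEQ_le_const[OF l]) auto
  ultimately show ?thesis using l by simp
qed

section \<open>The law of the waiting time\<close>

lemma (in prob_space) network_measurable:
  fixes Xs :: "nat \<Rightarrow> 'a \<Rightarrow> real" and s :: "nat \<Rightarrow> nat \<Rightarrow> 'a \<Rightarrow> real"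
  assumes "indep_vars (\<lambda>_. borel) (\<lambda>(j, n). if j = 0 then Xs n else s j n) ({0..m} \<times> UNIV)"
  shows "Xs i \<in> borel_measurable M" and "j \<in> {1..m} \<Longrightarrow> s j i \<in> borel_measurable M"
proof -
  have meas: "(if j = 0 then Xs i else s j i) \<in> borel_measurable M" if "j \<in> {0..m}" for i j
    using assms that by (auto simp: indep_vars_def)
  show "Xs i \<in> borel_measurable M" using meas[of 0 i] by simp
  show "s j i \<in> borel_measurable M" if "j \<in> {1..m}" using meas[of j i] that by simp
qed

lemma departure_measurable:
  assumes "\<And>i. Xs i \<in> borel_measurable N" "\<And>j i. j \<in> {1..M} \<Longrightarrow> s j i \<in> borel_measurable N"
  shows "j \<le> M \<Longrightarrow> (\<lambda>\<omega>. departure (\<lambda>i. Xs i \<omega>) (\<lambda>j i. s j i \<omega>) j n) \<in> borel_measurable N"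
proof (induction j arbitrary: n)
  case 0
  show ?case using assms(1) by simp
next
  case (Suc j)
  have [measurable]: "s (Suc j) i \<in> borel_measurable N" for i using Suc.prems by (intro assms(2)) auto
  have [measurable]: "(\<lambda>\<omega>. departure (\<lambda>i. Xs i \<omega>) (\<lambda>j i. s j i \<omega>) j n) \<in> borel_measurable N" for n
    using Suc by simp
  show ?case by (induction n) simp_all
qed

lemma waiting_time_measurable:
  assumes "\<And>i. Xs i \<in> borel_measurable N" "\<And>j i. j \<in> {1..M} \<Longrightarrow> s j i \<in> borel_measurable N"
  shows "(\<lambda>\<omega>. waiting_time M (\<lambda>i. Xs i \<omega>) (\<lambda>j i. s j i \<omega>) n) \<in> borel_measurable N"
  unfolding waiting_time_def using assms
  by (intro borel_measurable_diff departure_measurable[where M = M] borel_measurable_sum) auto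

text \<open>
  The starting vector of the walk, as a function of an array indexed by (queue, diagonal).
\<close>

definition initial_slack :: "nat \<Rightarrow> real \<Rightarrow> (nat \<times> nat \<Rightarrow> real) \<Rightarrow> nat \<Rightarrow> ereal" where
  "initial_slack M x y =
     (\<lambda>j\<in>{1..M}. ereal (x + (\<Sum>k=1..M. y (M + 1 - k, k)) - prefix_max M (\<lambda>l k. y (l, k)) j))"

lemma prefix_max_cong:
  assumes "j \<in> {1..M}" "\<And>l k. l \<in> {1..M} \<Longrightarrow> k \<in> {1..M} \<Longrightarrow> y l k = y' l k"
  shows "prefix_max M y j = prefix_max M y' j"
proof -
  have "prefix_sum M y M j i = prefix_sum M y' M j i" if "i \<in> prefix_chains M M j" for i
  proof -
    have "i l \<le> M" if "l \<in> {Suc j..Suc M}" for l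
      using \<open>i \<in> prefix_chains M M j\<close> that by (auto simp: prefix_chains_def PiE_iff)
    then show ?thesis
      unfolding prefix_sum_def using assms(1)
      by (intro arg_cong2[where f = "(+)"] sum.cong refl assms(2)) (auto intro: order_trans)
  qed
  then show ?thesis unfolding prefix_max_eq by (simp cong: image_cong)
qed

lemma initial_slack_cong:
  assumes "\<And>p. p \<in> {1..M} \<times> {1..M} \<Longrightarrow> y p = y' p"
  shows "initial_slack M x y = initial_slack M x y'"
proof -
  have "(\<Sum>k=1..M. y (M + 1 - k, k)) = (\<Sum>k=1..M. y' (M + 1 - k, k))"
    by (intro sum.cong assms) auto
  moreover have "prefix_max M (\<lambda>l k. y (l, k)) j = prefix_max M (\<lambda>l k. y' (l, k)) j" if "j \<in> {1..M}" for j
    using that assms by (intro prefix_max_cong) auto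
  ultimately show ?thesis by (auto simp: initial_slack_def restrict_def)
qed

lemma initial_slack_measurable:
  "initial_slack M x \<in> (\<Pi>\<^sub>M p\<in>{1..M} \<times> {1..M}. borel) \<rightarrow>\<^sub>M ereal_vec M"
proof -
  let ?N = "\<Pi>\<^sub>M p\<in>{1..M} \<times> {1..M}. (borel :: real measure)"
  have comp: "(\<lambda>y. y (l, k)) \<in> borel_measurable ?N" if "l \<in> {1..M}" "k \<in> {1..M}" for l k
    using that by (intro measurable_component_singleton) auto
  have "(\<lambda>y. prefix_max M (\<lambda>l k. y (l, k)) j) \<in> borel_measurable ?N" if j: "j \<in> {1..M}" for j
    unfolding prefix_max_eq
  proof (rule borel_measurable_Max[OF finite_prefix_chains])
    fix i assume i: "i \<in> prefix_chains M M j"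
    have "i l \<le> M" if "l \<in> {Suc j..Suc M}" for l
      using i that by (auto simp: prefix_chains_def PiE_iff)
    then show "(\<lambda>y. prefix_sum M (\<lambda>l k. y (l, k)) M j i) \<in> borel_measurable ?N"
      unfolding prefix_sum_def using j
      by (intro borel_measurable_add borel_measurable_sum comp) (auto intro: order_trans)
  qed
  then show ?thesis
    unfolding initial_slack_def[abs_def]
    by (intro measurable_restrict borel_measurable_ereal borel_measurable_diff borel_measurable_add
        borel_measurable_sum comp borel_measurable_const) auto
qed

text \<open>
  The job at queue \<open>j\<close> on diagonal \<open>k\<close>; for \<open>j = 0\<close> the inter-arrival time that is subtracted
  there, which belongs to the job at queue 1. Positions without a job are sent to indices above
  \<open>n + M\<close>, which keeps the map injective and hence the whole array independent.
\<close>

definition job_index :: "nat \<Rightarrow> nat \<Rightarrow> nat \<Rightarrow> nat \<Rightarrow> nat" where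
  "job_index M n j k =
     (if max j 1 + k \<le> n + M + 1 then n + M + 1 - max j 1 - k else n + M + k)"

lemma inj_on_job_index: "inj_on (\<lambda>p. (fst p, job_index M n (fst p) (snd p))) (A \<times> {1..})"
  by (auto simp: inj_on_def job_index_def max_def split: if_splits)

context tandem_steps
begin

lemma sets_sequence: "sets (\<Pi>\<^sub>M k\<in>(UNIV::nat set). \<mu>) = sets (\<Pi>\<^sub>M k\<in>(UNIV::nat set). \<Pi>\<^sub>M j\<in>{1..M}. borel)"
  by (intro sets_PiM_cong) (auto simp: sets_\<mu>)

lemma survives_set:
  assumes "v \<in> space (ereal_vec M)"
  shows "{u \<in> space (\<Pi>\<^sub>M k\<in>UNIV. \<mu>). survives M n v u} \<in> sets (\<Pi>\<^sub>M k\<in>UNIV. \<mu>)"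
  using survives_measurable[of "\<lambda>_. v" "\<Pi>\<^sub>M k\<in>UNIV. \<mu>" "\<lambda>u. u" n] assms by (simp add: pred_def)

lemma emeasure_survives_forever:
  assumes v: "v \<in> space (ereal_vec M)"
  shows "emeasure (\<Pi>\<^sub>M k\<in>UNIV. \<mu>) {u \<in> space (\<Pi>\<^sub>M k\<in>UNIV. \<mu>). \<forall>n. survives M n v u} = eternal_prob v"
proof -
  let ?S = "\<Pi>\<^sub>M k\<in>(UNIV::nat set). \<mu>" and ?A = "\<lambda>n. {u \<in> space (\<Pi>\<^sub>M k\<in>UNIV. \<mu>). survives M n v u}"
  have "eternal_prob v = (INF n. emeasure ?S (?A n))"
    by (simp add: eternal_prob_def emeasure_survives[OF v])
  also have "\<dots> = emeasure ?S (\<Inter>n. ?A n)"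
  proof (rule INF_emeasure_decseq)
    show "range ?A \<subseteq> sets ?S" using survives_set[OF v] by auto
    show "decseq ?A" using survives_antimono by (intro decseq_SucI) blast
    show "emeasure ?S (?A n) \<noteq> \<infinity>" for n
      using survival_prob_le_1[OF v, of n] by (auto simp: emeasure_survives[OF v] top_unique)
  qed
  also have "(\<Inter>n. ?A n) = {u \<in> space ?S. \<forall>n. survives M n v u}" by auto
  finally show ?thesis by simp
qed

lemma psi_eq_eternal_prob:
  assumes \<Omega>: "prob_space \<Omega>"
    and indep: "prob_space.indep_vars \<Omega> (\<lambda>_. \<Pi>\<^sub>M j\<in>{1..M}. borel) (\<lambda>k \<omega>. \<lambda>j\<in>{1..M}. Vc j k \<omega>) {1..}"
    and law: "\<And>k. k \<ge> 1 \<Longrightarrow> distr \<Omega> (\<Pi>\<^sub>M j\<in>{1..M}. borel) (\<lambda>\<omega>. \<lambda>j\<in>{1..M}. Vc j k \<omega>) = \<mu>"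
    and v: "v \<in> space (ereal_vec M)"
  shows "ennreal (psi \<Omega> M Vc v) = eternal_prob v"
proof -
  interpret O: prob_space \<Omega> by fact
  let ?N = "\<Pi>\<^sub>M j\<in>{1..M}. (borel :: real measure)" and ?S = "\<Pi>\<^sub>M k\<in>(UNIV::nat set). \<mu>"
  define U where "U k \<omega> = (\<lambda>j\<in>{1..M}. Vc j (Suc k) \<omega>)" for k \<omega>
  have "O.indep_vars (\<lambda>_. ?N) (\<lambda>k \<omega>. \<lambda>j\<in>{1..M}. Vc j (Suc k) \<omega>) UNIV"
    by (rule O.indep_vars_reindex[OF indep]) auto
  then have U: "O.indep_vars (\<lambda>_. ?N) U UNIV" by (simp add: U_def[abs_def])
  have law_U: "distr \<Omega> (\<Pi>\<^sub>M k\<in>UNIV. ?N) (\<lambda>\<omega> k. U k \<omega>) = ?S"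
    by (rule O.distr_iid_sequence[OF U]) (simp add: U_def[abs_def] law)
  have U_meas: "(\<lambda>\<omega> k. U k \<omega>) \<in> \<Omega> \<rightarrow>\<^sub>M (\<Pi>\<^sub>M k\<in>UNIV. ?N)"
    using U measurable_restrict[of UNIV U \<Omega> "\<lambda>_. ?N"] by (simp add: O.indep_vars_def restrict_UNIV)
  let ?A = "{u \<in> space ?S. \<forall>n. survives M n v u}"
  have A: "?A \<in> sets (\<Pi>\<^sub>M k\<in>UNIV. ?N)"
  proof -
    have "?A = (\<Inter>n. {u \<in> space ?S. survives M n v u})" by auto
    also have "\<dots> \<in> sets ?S" using survives_set[OF v] by (intro sets.countable_INT) auto
    finally show ?thesis by (simp add: sets_sequence)
  qed
  have "eternal_prob v = emeasure (distr \<Omega> (\<Pi>\<^sub>M k\<in>UNIV. ?N) (\<lambda>\<omega> k. U k \<omega>)) ?A"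
    by (simp only: law_U emeasure_survives_forever[OF v])
  also have "\<dots> = emeasure \<Omega> ((\<lambda>\<omega> k. U k \<omega>) -` ?A \<inter> space \<Omega>)"
    by (rule emeasure_distr[OF U_meas A])
  also have "(\<lambda>\<omega> k. U k \<omega>) -` ?A \<inter> space \<Omega> =
      {\<omega> \<in> space \<Omega>. \<forall>j\<in>{1..M}. tandem_sup (\<lambda>l k. Vc l k \<omega>) j \<le> v j}"
    using measurable_space[OF U_meas] sets_eq_imp_space_eq[OF sets_sequence]
    unfolding tandem_sup_le_iff_survives[OF M] U_def by auto
  finally show ?thesis by (simp add: psi_def O.emeasure_eq_measure)
qed

text \<open>
  Seen from job \<open>n\<close>, the network is an independent array: its first \<open>M\<close> diagonals determine the
  starting vector, and the later ones are i.i.d. steps independent of it. Fubini then integrates the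
  survival probability over the starting vector.
\<close>

lemma emeasure_waiting_time_le:
  fixes D :: "nat \<Rightarrow> real measure"
  assumes \<Omega>: "prob_space \<Omega>"
    and indep: "prob_space.indep_vars \<Omega> (\<lambda>_. borel) (\<lambda>(j, n). if j = 0 then Xs n else s j n) ({0..M} \<times> UNIV)"
    and laws: "\<And>n. distr \<Omega> borel (Xs n) = D 0" "\<And>j n. j \<in> {1..M} \<Longrightarrow> distr \<Omega> borel (s j n) = D j"
    and \<mu>: "\<mu> = distr (\<Pi>\<^sub>M j\<in>{0..M}. D j) (\<Pi>\<^sub>M j\<in>{1..M}. borel) (\<lambda>z. \<lambda>j\<in>{1..M}. z j - z 0)"
    and nonneg: "\<And>j. j \<in> {1..M} \<Longrightarrow> AE \<omega> in \<Omega>. 0 \<le> s j 0 \<omega>"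
    and x: "0 \<le> x"
  shows "emeasure \<Omega> {\<omega> \<in> space \<Omega>. waiting_time M (\<lambda>i. Xs i \<omega>) (\<lambda>j i. s j i \<omega>) n \<le> x} =
    (\<integral>\<^sup>+y. survival_prob n (initial_slack M x y) \<partial>(\<Pi>\<^sub>M p\<in>{1..M} \<times> {1..M}. D (fst p)))"
proof -
  interpret O: prob_space \<Omega> by fact
  let ?N = "\<Pi>\<^sub>M j\<in>{1..M}. (borel :: real measure)"
  let ?S = "\<Pi>\<^sub>M k\<in>(UNIV::nat set). \<mu>" and ?SN = "\<Pi>\<^sub>M k\<in>(UNIV::nat set). \<Pi>\<^sub>M j\<in>{1..M}. (borel :: real measure)"
  let ?B = "{1..M} \<times> {1..M}"
  let ?PB = "\<Pi>\<^sub>M p\<in>{1..M} \<times> {1..M}. (borel :: real measure)"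
  define Z where "Z p = (\<lambda>(j, n). if j = 0 then Xs n else s j n) (fst p, job_index M n (fst p) (snd p))" for p
  have Z: "O.indep_vars (\<lambda>_. borel) Z ({0..M} \<times> {1..})"
    unfolding Z_def by (rule O.indep_vars_reindex[OF indep inj_on_job_index]) auto
  have Z_law: "distr \<Omega> borel (Z p) = D (fst p)" if "p \<in> {0..M} \<times> {1..}" for p
    using that laws by (auto simp: Z_def)
  note Xs_meas = O.network_measurable(1)[OF indep] and s_meas = O.network_measurable(2)[OF indep]
  define y where "y \<omega> = restrict (\<lambda>p. Z p \<omega>) ?B" for \<omega>
  define U where "U k \<omega> = (\<lambda>j\<in>{1..M}. Z (j, M + Suc k) \<omega> - Z (0, M + Suc k) \<omega>)" for k \<omega>
  let ?later = "\<lambda>k. {0..M} \<times> {M + Suc k}"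
  have law_y: "distr \<Omega> ?PB y = (\<Pi>\<^sub>M p\<in>?B. D (fst p))"
    unfolding y_def
    by (rule O.distr_indep_family[OF O.indep_vars_subset[OF Z]]) (use M in \<open>auto intro!: Z_law\<close>)
  have law_U: "distr \<Omega> ?SN (\<lambda>\<omega> k. U k \<omega>) = ?S"
  proof (rule O.distr_iid_sequence)
    have "O.indep_vars (\<lambda>k. PiM (?later k) (\<lambda>_. borel)) (\<lambda>k \<omega>. restrict (\<lambda>p. Z p \<omega>) (?later k)) UNIV"
      by (rule O.indep_vars_restrict[OF Z]) (auto simp: disjoint_family_on_def)
    then have "O.indep_vars (\<lambda>_. ?N) (\<lambda>k \<omega>. (\<lambda>r. \<lambda>j\<in>{1..M}. r (j, M + Suc k) - r (0, M + Suc k))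
        (restrict (\<lambda>p. Z p \<omega>) (?later k))) UNIV"
      by (rule O.indep_vars_compose2)
         (intro measurable_restrict borel_measurable_diff measurable_component_singleton, auto)
    also have "(\<lambda>k \<omega>. (\<lambda>r. \<lambda>j\<in>{1..M}. r (j, M + Suc k) - r (0, M + Suc k))
        (restrict (\<lambda>p. Z p \<omega>) (?later k))) = U"
      by (auto simp: U_def fun_eq_iff)
    finally show "O.indep_vars (\<lambda>_. ?N) U UNIV" .
    fix k
    have "O.indep_vars (\<lambda>_. borel) (\<lambda>j. Z (j, M + Suc k)) {0..M}"
      by (rule O.indep_vars_reindex[OF Z]) (auto simp: inj_on_def)
    then show "distr \<Omega> ?N (U k) = \<mu>"
      unfolding U_def[abs_def] \<mu> by (rule O.distr_increments) (auto simp: Z_law)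
  qed
  let ?L = "{0..M} \<times> {M<..}"
  let ?PL = "\<Pi>\<^sub>M p\<in>{0..M} \<times> {M<..}. (borel :: real measure)"
  define R where "R \<omega> = restrict (\<lambda>p. Z p \<omega>) ?L" for \<omega>
  define f where "f r = (\<lambda>k. \<lambda>j\<in>{1..M}. r (j, M + Suc k) - r (0, M + Suc k))"
    for r :: "nat \<times> nat \<Rightarrow> real"
  have f_R: "f (R \<omega>) = (\<lambda>k. U k \<omega>)" for \<omega>
    by (auto simp: f_def R_def U_def fun_eq_iff)
  have f_meas: "f \<in> ?PL \<rightarrow>\<^sub>M ?SN"
  proof -
    have "(\<lambda>r. \<lambda>j\<in>{1..M}. r (j, M + Suc k) - r (0, M + Suc k)) \<in> ?PL \<rightarrow>\<^sub>M ?N" for k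
      by (intro measurable_restrict borel_measurable_diff measurable_component_singleton) auto
    then show ?thesis
      unfolding f_def by (intro measurable_PiM_single') (auto simp: space_PiM)
  qed
  have "O.indep_var ?PB y ?PL R"
    unfolding y_def R_def by (rule O.indep_var_restrict[OF Z]) auto
  then have y_meas: "y \<in> \<Omega> \<rightarrow>\<^sub>M ?PB" and R_meas: "R \<in> \<Omega> \<rightarrow>\<^sub>M ?PL"
    and joint_law: "(\<Pi>\<^sub>M p\<in>?B. D (fst p)) \<Otimes>\<^sub>M distr \<Omega> ?PL R = distr \<Omega> (?PB \<Otimes>\<^sub>M ?PL) (\<lambda>\<omega>. (y \<omega>, R \<omega>))"
    unfolding O.indep_var_distribution_eq law_y by blast+
  have law_fR: "distr (distr \<Omega> ?PL R) ?SN f = ?S"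
    unfolding distr_distr[OF f_meas R_meas] law_U[symmetric] by (simp add: comp_def f_R)
  have sets_D: "sets (\<Pi>\<^sub>M p\<in>?B. D (fst p)) = sets ?PB"
    unfolding law_y[symmetric] by simp
  let ?Q = "\<lambda>p. survives M n (initial_slack M x (fst p)) (f (snd p))"
  have Q: "Measurable.pred (?PB \<Otimes>\<^sub>M ?PL) ?Q"
  proof (rule survives_measurable)
    show "(\<lambda>p. initial_slack M x (fst p)) \<in> ?PB \<Otimes>\<^sub>M ?PL \<rightarrow>\<^sub>M ereal_vec M"
      by (rule measurable_compose[OF measurable_fst initial_slack_measurable])
    show "(\<lambda>p. f (snd p)) \<in> ?PB \<Otimes>\<^sub>M ?PL \<rightarrow>\<^sub>M ?S"
      unfolding measurable_cong_sets[OF refl sets_sequence]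
      by (rule measurable_compose[OF measurable_snd f_meas])
  qed
  let ?A = "{p \<in> space (?PB \<Otimes>\<^sub>M ?PL). ?Q p}"
  have A: "?A \<in> sets (?PB \<Otimes>\<^sub>M ?PL)" using Q by (simp add: pred_def)
  have yR_meas: "(\<lambda>\<omega>. (y \<omega>, R \<omega>)) \<in> \<Omega> \<rightarrow>\<^sub>M ?PB \<Otimes>\<^sub>M ?PL"
    by (intro measurable_Pair y_meas R_meas)
  have "emeasure \<Omega> {\<omega> \<in> space \<Omega>. waiting_time M (\<lambda>i. Xs i \<omega>) (\<lambda>j i. s j i \<omega>) n \<le> x} =
      emeasure \<Omega> ((\<lambda>\<omega>. (y \<omega>, R \<omega>)) -` ?A \<inter> space \<Omega>)"
  proof (rule emeasure_eq_AE)
    have "AE \<omega> in \<Omega>. \<forall>j\<in>{1..M}. 0 \<le> s j 0 \<omega>"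
      using nonneg by (simp add: AE_ball_countable)
    then show "AE \<omega> in \<Omega>. \<omega> \<in> {\<omega> \<in> space \<Omega>. waiting_time M (\<lambda>i. Xs i \<omega>) (\<lambda>j i. s j i \<omega>) n \<le> x} \<longleftrightarrow>
        \<omega> \<in> (\<lambda>\<omega>. (y \<omega>, R \<omega>)) -` ?A \<inter> space \<Omega>"
      using AE_space
    proof eventually_elim
      case (elim \<omega>)
      have "waiting_time M (\<lambda>i. Xs i \<omega>) (\<lambda>j i. s j i \<omega>) n \<le> x \<longleftrightarrow>
          survives M n (\<lambda>j\<in>{1..M}. ereal (x + (\<Sum>k=1..M. (\<lambda>l k. y \<omega> (l, k)) (M + 1 - k) k)
             - prefix_max M (\<lambda>l k. y \<omega> (l, k)) j)) (\<lambda>k. U k \<omega>)"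
      proof (rule waiting_time_le_iff_survives[OF M _ x])
        show "0 \<le> s j 0 \<omega>" if "j \<in> {1..M}" for j using elim that by blast
        show "y \<omega> (j, k) = s j (n + M + 1 - j - k) \<omega>"
          if "k \<in> {1..M}" "j \<in> {1..M}" "j + k \<le> n + M + 1" for k j
          using that by (auto simp: y_def Z_def job_index_def)
        show "U k \<omega> j = s j (n - j - k) \<omega> - Xs (n - 1 - k) \<omega>"
          if "k < n" "j \<in> {1..M}" "j + k \<le> n" for k j
        proof -
          have "job_index M n j (M + Suc k) = n - j - k" "job_index M n 0 (M + Suc k) = n - 1 - k"
            using that by (auto simp: job_index_def)
          then show ?thesis using that by (simp add: U_def Z_def)
        qed
      qed
      then show ?case
        using elim measurable_space[OF yR_meas, of \<omega>] by (simp add: initial_slack_def f_R)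
    qed
    show "{\<omega> \<in> space \<Omega>. waiting_time M (\<lambda>i. Xs i \<omega>) (\<lambda>j i. s j i \<omega>) n \<le> x} \<in> sets \<Omega>"
      using waiting_time_measurable[of Xs \<Omega> M s n] Xs_meas s_meas by simp
    show "(\<lambda>\<omega>. (y \<omega>, R \<omega>)) -` ?A \<inter> space \<Omega> \<in> sets \<Omega>"
      by (rule measurable_sets[OF yR_meas A])
  qed
  also have "\<dots> = emeasure (distr \<Omega> (?PB \<Otimes>\<^sub>M ?PL) (\<lambda>\<omega>. (y \<omega>, R \<omega>))) ?A"
    by (rule emeasure_distr[OF yR_meas A, symmetric])
  also have "\<dots> = emeasure ((\<Pi>\<^sub>M p\<in>?B. D (fst p)) \<Otimes>\<^sub>M distr \<Omega> ?PL R) ?A"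
    by (simp only: joint_law)
  also have "\<dots> = (\<integral>\<^sup>+y. emeasure (distr \<Omega> ?PL R) (Pair y -` ?A) \<partial>(\<Pi>\<^sub>M p\<in>?B. D (fst p)))"
  proof -
    interpret R: prob_space "distr \<Omega> ?PL R" by (rule O.prob_space_distr[OF R_meas])
    show ?thesis
      by (rule R.emeasure_pair_measure_alt) (use A in \<open>simp only: joint_law sets_distr\<close>)
  qed
  also have "\<dots> = (\<integral>\<^sup>+y. survival_prob n (initial_slack M x y) \<partial>(\<Pi>\<^sub>M p\<in>?B. D (fst p)))"
  proof (rule nn_integral_cong)
    fix y assume "y \<in> space (\<Pi>\<^sub>M p\<in>?B. D (fst p))"
    then have y: "y \<in> space ?PB" using sets_eq_imp_space_eq[OF sets_D] by simp
    let ?v = "initial_slack M x y"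
    have v: "?v \<in> space (ereal_vec M)" by (rule measurable_space[OF initial_slack_measurable y])
    have "Pair y -` ?A = f -` {u \<in> space ?S. survives M n ?v u} \<inter> space (distr \<Omega> ?PL R)"
      using y measurable_space[OF f_meas] sets_eq_imp_space_eq[OF sets_sequence]
      by (auto simp: space_pair_measure)
    also have "emeasure (distr \<Omega> ?PL R) \<dots> =
        emeasure (distr (distr \<Omega> ?PL R) ?SN f) {u \<in> space ?S. survives M n ?v u}"
      using f_meas survives_set[OF v] by (intro emeasure_distr[symmetric]) (auto simp: sets_sequence)
    finally show "emeasure (distr \<Omega> ?PL R) (Pair y -` ?A) = survival_prob n ?v"
      unfolding law_fR using emeasure_survives[OF v] by simp
  qed
  finally show ?thesis .
qed

end

context tandem_steps
begin

text \<open>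
  By the formula for finite \<open>n\<close> the distribution functions decrease on \<open>x \<ge> 0\<close>, so they converge there to the one
  of \<open>W\<close>; the integrals converge by monotone convergence.
\<close>

lemma emeasure_stationary_waiting_time_le:
  fixes D :: "nat \<Rightarrow> real measure"
  assumes \<Omega>: "prob_space \<Omega>"
    and indep: "prob_space.indep_vars \<Omega> (\<lambda>_. borel) (\<lambda>(j, n). if j = 0 then Xs n else s j n) ({0..M} \<times> UNIV)"
    and laws: "\<And>n. distr \<Omega> borel (Xs n) = D 0" "\<And>j n. j \<in> {1..M} \<Longrightarrow> distr \<Omega> borel (s j n) = D j"
    and \<mu>: "\<mu> = distr (\<Pi>\<^sub>M j\<in>{0..M}. D j) (\<Pi>\<^sub>M j\<in>{1..M}. borel) (\<lambda>z. \<lambda>j\<in>{1..M}. z j - z 0)"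
    and nonneg: "\<And>j. j \<in> {1..M} \<Longrightarrow> AE \<omega> in \<Omega>. 0 \<le> s j 0 \<omega>"
    and W: "W \<in> borel_measurable \<Omega>"
      "weak_conv_m (\<lambda>n. distr \<Omega> borel (\<lambda>\<omega>. waiting_time M (\<lambda>i. Xs i \<omega>) (\<lambda>j i. s j i \<omega>) n))
         (distr \<Omega> borel W)"
    and x: "0 \<le> x"
  shows "emeasure \<Omega> {\<omega> \<in> space \<Omega>. W \<omega> \<le> x} =
    (\<integral>\<^sup>+y. eternal_prob (initial_slack M x y) \<partial>(\<Pi>\<^sub>M p\<in>{1..M} \<times> {1..M}. D (fst p)))"
proof -
  interpret O: prob_space \<Omega> by fact
  let ?Py = "\<Pi>\<^sub>M p\<in>{1..M} \<times> {1..M}. D (fst p)"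
  define w where "w n \<omega> = waiting_time M (\<lambda>i. Xs i \<omega>) (\<lambda>j i. s j i \<omega>) n" for n \<omega>
  have w: "w n \<in> borel_measurable \<Omega>" for n
    unfolding w_def
    by (rule waiting_time_measurable[OF O.network_measurable[OF indep]])
  have cdf: "cdf (distr \<Omega> borel f) y = O.prob {\<omega> \<in> space \<Omega>. f \<omega> \<le> y}" if "f \<in> borel_measurable \<Omega>" for f y
    using that by (simp add: cdf_def measure_distr vimage_def Int_def conj_commute)
  have sets_D: "sets ?Py = sets (\<Pi>\<^sub>M p\<in>{1..M} \<times> {1..M}. borel)"
  proof (rule sets_PiM_cong)
    fix p assume p: "p \<in> {1..M} \<times> {1..M}"
    then have "D (fst p) = distr \<Omega> borel (s (fst p) 0)" using laws(2) by auto
    then show "sets (D (fst p)) = sets borel" by simp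
  qed simp
  have slack_meas: "initial_slack M y \<in> ?Py \<rightarrow>\<^sub>M ereal_vec M" for y
    using initial_slack_measurable by (simp add: measurable_cong_sets[OF sets_D refl])
  have cdf_w: "ennreal (cdf (distr \<Omega> borel (w n)) y) = (\<integral>\<^sup>+z. survival_prob n (initial_slack M y z) \<partial>?Py)"
    if "0 \<le> y" for n y
    using emeasure_waiting_time_le[OF \<Omega> indep laws \<mu> nonneg that, of n]
    by (simp add: cdf[OF w] w_def O.emeasure_eq_measure)
  have dec: "decseq (\<lambda>n z. survival_prob n (initial_slack M y z))" for y
    by (intro decseq_SucI le_funI survival_prob_decreasing) (simp add: initial_slack_def space_ereal_vec)
  have lim: "(\<lambda>n. cdf (distr \<Omega> borel (w n)) x) \<longlonglongrightarrow> cdf (distr \<Omega> borel W) x"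
  proof (rule cdf_tendsto_of_decreasing_cdfs)
    show "real_distribution (distr \<Omega> borel (w n))" for n using w by (rule O.real_distribution_distr)
    show "real_distribution (distr \<Omega> borel W)" using W(1) by (rule O.real_distribution_distr)
    show "weak_conv_m (\<lambda>n. distr \<Omega> borel (w n)) (distr \<Omega> borel W)" using W(2) by (simp add: w_def[abs_def])
    fix y assume "x \<le> y"
    then have y: "0 \<le> y" using x by simp
    show "decseq (\<lambda>n. cdf (distr \<Omega> borel (w n)) y)"
    proof (rule decseq_SucI)
      fix n
      have "ennreal (cdf (distr \<Omega> borel (w (Suc n))) y) \<le> ennreal (cdf (distr \<Omega> borel (w n)) y)"
        unfolding cdf_w[OF y] using decseq_SucD[OF dec[of y]] by (intro nn_integral_mono) (auto simp: le_fun_def)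
      then show "cdf (distr \<Omega> borel (w (Suc n))) y \<le> cdf (distr \<Omega> borel (w n)) y"
        by (simp add: cdf_def)
    qed
  qed
  have "(\<lambda>n. \<integral>\<^sup>+z. survival_prob n (initial_slack M x z) \<partial>?Py) \<longlonglongrightarrow> ennreal (cdf (distr \<Omega> borel W) x)"
    using tendsto_ennrealI[OF lim] by (simp only: cdf_w[OF x])
  moreover have "(\<lambda>n. \<integral>\<^sup>+z. survival_prob n (initial_slack M x z) \<partial>?Py) \<longlonglongrightarrow>
      (\<integral>\<^sup>+z. eternal_prob (initial_slack M x z) \<partial>?Py)"
  proof -
    have "(\<integral>\<^sup>+z. eternal_prob (initial_slack M x z) \<partial>?Py) =
        (INF n. \<integral>\<^sup>+z. survival_prob n (initial_slack M x z) \<partial>?Py)"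
      unfolding eternal_prob_def
    proof (rule nn_integral_monotone_convergence_INF_decseq[OF dec])
      show "(\<lambda>z. survival_prob n (initial_slack M x z)) \<in> borel_measurable ?Py" for n
        by (rule measurable_compose[OF slack_meas survival_prob_measurable])
      show "(\<integral>\<^sup>+z. survival_prob 0 (initial_slack M x z) \<partial>?Py) < \<infinity>"
        unfolding cdf_w[OF x, symmetric] by simp
    qed
    moreover have "decseq (\<lambda>n. \<integral>\<^sup>+z. survival_prob n (initial_slack M x z) \<partial>?Py)"
      by (intro decseq_SucI nn_integral_mono le_funD[OF decseq_SucD[OF dec]])
    ultimately show ?thesis using LIMSEQ_INF by metis
  qed
  ultimately have "ennreal (cdf (distr \<Omega> borel W) x) = (\<integral>\<^sup>+z. eternal_prob (initial_slack M x z) \<partial>?Py)"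
    by (rule LIMSEQ_unique)
  then show ?thesis by (simp add: cdf[OF W(1)] O.emeasure_eq_measure)
qed

end

section \<open>Bounds on the stationary waiting time\<close>

text \<open>
  With \<open>expectation_ext_nonneg\<close> this transfers the hypotheses to nonnegative integrals: the positive part
  of \<open>\<gamma>\<close> suffices for an upper bound.
\<close>

lemma expectation_ext_le: "expectation_ext N f \<le> enn2ereal (\<integral>\<^sup>+\<omega>. ennreal (f \<omega>) \<partial>N)"
  unfolding expectation_ext_def
  by (rule ereal_diff_le_self) simp

lemma expectation_ext_nonneg:
  assumes "AE \<omega> in N. 0 \<le> f \<omega>"
  shows "expectation_ext N f = enn2ereal (\<integral>\<^sup>+\<omega>. ennreal (f \<omega>) \<partial>N)"
proof -
  have "(\<integral>\<^sup>+\<omega>. ennreal (- f \<omega>) \<partial>N) = (\<integral>\<^sup>+\<omega>. 0 \<partial>N)"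
    using assms by (intro nn_integral_cong_AE) (auto elim!: eventually_mono simp: ennreal_neg)
  then show ?thesis by (simp add: expectation_ext_def zero_ennreal.rep_eq)
qed

theorem corollary5:
  fixes \<Omega> :: "'a measure" and M :: nat
    and X :: "'a \<Rightarrow> real" and Y V :: "nat \<Rightarrow> 'a \<Rightarrow> real"
    and Xs :: "nat \<Rightarrow> 'a \<Rightarrow> real" and s :: "nat \<Rightarrow> nat \<Rightarrow> 'a \<Rightarrow> real"
    and W :: "'a \<Rightarrow> real"
    and Vc Yc :: "nat \<Rightarrow> nat \<Rightarrow> 'a \<Rightarrow> real"
    and \<gamma> \<eta> :: "(nat \<Rightarrow> ereal) \<Rightarrow> real" and K x :: real
  assumes prob: "prob_space \<Omega>"
    and M: "1 \<le> M"
    \<comment> \<open>generic inter-arrival time and service times\<close>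
    and generic_indep:
      "prob_space.indep_vars \<Omega> (\<lambda>_. borel) (\<lambda>j. if j = 0 then X else Y j) {0..M}"
    and X_nonneg: "AE \<omega> in \<Omega>. 0 \<le> X \<omega>"
    and Y_nonneg: "\<And>j. j \<in> {1..M} \<Longrightarrow> AE \<omega> in \<Omega>. 0 \<le> Y j \<omega>"
    and light_tailed:
      "\<And>j. j \<in> {1..M} \<Longrightarrow> \<exists>\<theta>>0. integrable \<Omega> (\<lambda>\<omega>. exp (\<theta> * Y j \<omega>))"
    and stable: "\<And>j. j \<in> {1..M} \<Longrightarrow> expectation_ext \<Omega> (Y j) < expectation_ext \<Omega> X"
    and V: "\<And>j \<omega>. V j \<omega> = Y j \<omega> - X \<omega>"
    and V_pos: "\<And>j. j \<in> {1..M} \<Longrightarrow> \<P>(\<omega> in \<Omega>. V j \<omega> > 0) > 0"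
    \<comment> \<open>the tandem network and its stationary end-to-end waiting time\<close>
    and network_indep:
      "prob_space.indep_vars \<Omega> (\<lambda>_. borel) (\<lambda>(j, n). if j = 0 then Xs n else s j n)
         ({0..M} \<times> UNIV)"
    and Xs_distr: "\<And>n. distr \<Omega> borel (Xs n) = distr \<Omega> borel X"
    and s_distr: "\<And>j n. j \<in> {1..M} \<Longrightarrow> distr \<Omega> borel (s j n) = distr \<Omega> borel (Y j)"
    and W_meas: "W \<in> borel_measurable \<Omega>"
    and W_limit:
      "weak_conv_m
         (\<lambda>n. distr \<Omega> borel (\<lambda>\<omega>. waiting_time M (\<lambda>i. Xs i \<omega>) (\<lambda>j i. s j i \<omega>) n))
         (distr \<Omega> borel W)"
    \<comment> \<open>i.i.d. copies of the vector of the \<open>V j\<close>\<close>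
    and Vc_indep:
      "prob_space.indep_vars \<Omega> (\<lambda>_. \<Pi>\<^sub>M j\<in>{1..M}. borel) (\<lambda>k \<omega>. \<lambda>j\<in>{1..M}. Vc j k \<omega>) {1..}"
    and Vc_distr:
      "\<And>k. k \<ge> 1 \<Longrightarrow> distr \<Omega> (\<Pi>\<^sub>M j\<in>{1..M}. borel) (\<lambda>\<omega>. \<lambda>j\<in>{1..M}. Vc j k \<omega>)
                    = distr \<Omega> (\<Pi>\<^sub>M j\<in>{1..M}. borel) (\<lambda>\<omega>. \<lambda>j\<in>{1..M}. V j \<omega>)"
    \<comment> \<open>independent copies of the \<open>Y j\<close>\<close>
    and Yc_indep:
      "prob_space.indep_vars \<Omega> (\<lambda>_. borel) (\<lambda>(j, k). Yc j k) ({1..M} \<times> {1..M})"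
    and Yc_distr:
      "\<And>j k. j \<in> {1..M} \<Longrightarrow> k \<in> {1..M} \<Longrightarrow> distr \<Omega> borel (Yc j k) = distr \<Omega> borel (Y j)"
    \<comment> \<open>the function \<open>\<gamma>\<close>\<close>
    and \<gamma>_meas: "\<gamma> \<in> borel_measurable (ereal_vec M)"
    and \<gamma>_le: "\<And>v. v \<in> {1..M} \<rightarrow>\<^sub>E UNIV \<Longrightarrow> \<gamma> v \<le> K"
    and \<gamma>_infty: "\<gamma> (infty_vec M) = 1"
    and \<gamma>_limsup: "Limsup (to_infty M) (\<lambda>v. ereal (\<gamma> v)) = 1"
    and \<gamma>_sub:
      "\<And>v. v \<in> support_on ({1..M} \<rightarrow>\<^sub>E UNIV) (\<lambda>v. max (\<gamma> v) 0) \<Longrightarrow>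
         expectation_ext \<Omega>
           (\<lambda>\<omega>. of_bool (v 1 \<ge> ereal (V 1 \<omega>)) * \<gamma> (shift_min M v (\<lambda>j. V j \<omega>)))
         \<ge> ereal (\<gamma> v)"
    \<comment> \<open>the function \<open>\<eta>\<close>\<close>
    and \<eta>_meas: "\<eta> \<in> borel_measurable (ereal_vec M)"
    and \<eta>_nonneg: "\<And>v. v \<in> {1..M} \<rightarrow>\<^sub>E UNIV \<Longrightarrow> 0 \<le> \<eta> v"
    and \<eta>_infty: "\<eta> (infty_vec M) = 1"
    and \<eta>_liminf: "Liminf (to_infty M) (\<lambda>v. ereal (\<eta> v)) = 1"
    and \<eta>_super:
      "\<And>v. v \<in> support_on ({1..M} \<rightarrow>\<^sub>E UNIV) (psi \<Omega> M Vc) \<Longrightarrow>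
         expectation_ext \<Omega>
           (\<lambda>\<omega>. of_bool (v 1 \<ge> ereal (V 1 \<omega>)) * \<eta> (shift_min M v (\<lambda>j. V j \<omega>)))
         \<le> ereal (\<eta> v)"
    and x: "0 \<le> x"
  shows "1 - expectation_ext \<Omega>
               (\<lambda>\<omega>. \<eta> (\<lambda>j\<in>{1..M}. ereal (x + (\<Sum>k=1..M. Yc (M + 1 - k) k \<omega>)
                                          - prefix_max M (\<lambda>l k. Yc l k \<omega>) j)))
           \<le> ereal (\<P>(\<omega> in \<Omega>. W \<omega> > x))
       \<and> ereal (\<P>(\<omega> in \<Omega>. W \<omega> > x))
           \<le> 1 - expectation_ext \<Omega>
               (\<lambda>\<omega>. \<gamma> (\<lambda>j\<in>{1..M}. ereal (x + (\<Sum>k=1..M. Yc (M + 1 - k) k \<omega>)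
                                          - prefix_max M (\<lambda>l k. Yc l k \<omega>) j)))"
proof -
  interpret prob_space \<Omega> by (rule prob)
  let ?N = "\<Pi>\<^sub>M j\<in>{1..M}. (borel :: real measure)"
  define D where "D j = distr \<Omega> borel (if j = 0 then X else Y j)" for j
  define \<mu> where "\<mu> = distr \<Omega> ?N (\<lambda>\<omega>. \<lambda>j\<in>{1..M}. V j \<omega>)"
  have generic_meas: "(if j = 0 then X else Y j) \<in> borel_measurable \<Omega>" if "j \<in> {0..M}" for j
    using generic_indep that by (auto simp: indep_vars_def)
  have X_meas: "X \<in> borel_measurable \<Omega>" using generic_meas[of 0] by simp
  have Y_meas: "Y j \<in> borel_measurable \<Omega>" if "j \<in> {1..M}" for j using generic_meas[of j] that by simp
  have V_meas: "V j \<in> borel_measurable \<Omega>" if "j \<in> {1..M}" for j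
    unfolding V[abs_def] using X_meas Y_meas[OF that] by measurable
  have V_vec_meas: "(\<lambda>\<omega>. \<lambda>j\<in>{1..M}. V j \<omega>) \<in> \<Omega> \<rightarrow>\<^sub>M ?N" using V_meas by (rule measurable_restrict)
  have \<mu>: "\<mu> = distr (\<Pi>\<^sub>M j\<in>{0..M}. D j) ?N (\<lambda>z. \<lambda>j\<in>{1..M}. z j - z 0)"
  proof -
    have "\<mu> = distr \<Omega> ?N (\<lambda>\<omega>. \<lambda>j\<in>{1..M}. (if j = 0 then X else Y j) \<omega> - (if 0 = (0::nat) then X else Y 0) \<omega>)"
      unfolding \<mu>_def by (intro distr_cong) (auto simp: V)
    then show ?thesis
      by (simp only: distr_increments[OF generic_indep D_def[symmetric]])
  qed
  have "prob_space \<mu>" unfolding \<mu>_def by (rule prob_space_distr[OF V_vec_meas])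
  then interpret \<mu>: tandem_steps \<mu> M
    using M by (simp add: tandem_steps_def tandem_steps_axioms_def \<mu>_def)

  have mean_less: "(\<integral>\<^sup>+\<omega>. ennreal (Y j \<omega>) \<partial>\<Omega>) < (\<integral>\<^sup>+\<omega>. ennreal (X \<omega>) \<partial>\<Omega>)" if "j \<in> {1..M}" for j
    using stable[OF that] X_nonneg Y_nonneg[OF that] by (simp add: expectation_ext_nonneg less_ennreal.rep_eq)
  obtain \<theta> \<rho> where \<theta>: "0 < \<theta>" and \<rho>: "0 \<le> \<rho>" "\<rho> < 1"
    and moment: "\<And>j. j \<in> {1..M} \<Longrightarrow> (\<integral>\<^sup>+\<omega>. ennreal (exp (\<theta> * (Y j \<omega> - X \<omega>))) \<partial>\<Omega>) \<le> ennreal \<rho>"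
    by (rule common_exponential_moment[OF X_meas X_nonneg Y_meas Y_nonneg light_tailed mean_less]) auto
  \<comment> \<open>A weight large enough for \<rho> * (1 + 1 / a) to stay below 1.\<close>
  define a where "a = 2 / (1 - \<rho>)"
  have a: "1 \<le> a" using \<rho> by (simp add: a_def field_simps)
  define r where "r = \<rho> * (1 + 1 / a)"
  interpret \<mu>: contracting_tandem \<mu> M a \<theta> r
  proof
    show "1 \<le> a" "0 < \<theta>" by fact+
    show "0 \<le> r" using \<rho> a by (simp add: r_def)
    have "r = \<rho> + \<rho> * (1 - \<rho>) / 2" by (simp add: r_def a_def algebra_simps)
    also have "\<dots> < 1"
      using \<rho> mult_strict_right_mono[of \<rho> 1 "1 - \<rho>"] by (simp add: field_simps)
    finally show "r < 1" .
    fix j assume j: "j \<in> {1..M}"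
    have "(\<integral>\<^sup>+u. ennreal (exp (\<theta> * u j)) \<partial>\<mu>) = (\<integral>\<^sup>+\<omega>. ennreal (exp (\<theta> * (Y j \<omega> - X \<omega>))) \<partial>\<Omega>)"
    proof -
      have [measurable]: "(\<lambda>u. u j) \<in> borel_measurable ?N" using j by measurable
      show ?thesis
        unfolding \<mu>_def using j by (subst nn_integral_distr[OF V_vec_meas]) (auto simp: V)
    qed
    also have "\<dots> \<le> ennreal \<rho>" by (rule moment[OF j])
    also have "\<rho> = r / (1 + 1 / a)"
    proof -
      have "1 + 1 / a \<noteq> 0" using a by (smt (verit) divide_nonneg_nonneg)
      then show ?thesis by (simp add: r_def)
    qed
    finally show "(\<integral>\<^sup>+u. ennreal (exp (\<theta> * u j)) \<partial>\<mu>) \<le> ennreal (r / (1 + 1 / a))" .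
  qed

  have step_eq: "\<mu>.step (\<lambda>v. ennreal (h v)) v =
      (\<integral>\<^sup>+\<omega>. ennreal (of_bool (v 1 \<ge> ereal (V 1 \<omega>)) * h (shift_min M v (\<lambda>j. V j \<omega>))) \<partial>\<Omega>)"
    if h: "h \<in> borel_measurable (ereal_vec M)" and v: "v \<in> {1..M} \<rightarrow>\<^sub>E UNIV" for h v
  proof -
    have h': "(\<lambda>v. ennreal (h v)) \<in> borel_measurable (ereal_vec M)" using h by measurable
    have "v \<in> space (ereal_vec M)" using v by (simp add: \<mu>.space_ereal_vec)
    note meas = \<mu>.step_integrand_measurable'[OF h' this, unfolded \<mu>_def]
    have "shift_min M v (\<lambda>j\<in>{1..M}. V j \<omega>) = shift_min M v (\<lambda>j. V j \<omega>)" for \<omega>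
      by (rule shift_min_cong) auto
    note integrand = this M
    have "\<mu>.step (\<lambda>v. ennreal (h v)) v =
        (\<integral>\<^sup>+u. (if ereal (u 1) \<le> v 1 then ennreal (h (shift_min M v u)) else 0) \<partial>distr \<Omega> ?N (\<lambda>\<omega>. \<lambda>j\<in>{1..M}. V j \<omega>))"
      by (simp only: \<mu>.step_def flip: \<mu>_def)
    also have "\<dots> = (\<integral>\<^sup>+\<omega>. ennreal (of_bool (v 1 \<ge> ereal (V 1 \<omega>)) * h (shift_min M v (\<lambda>j. V j \<omega>))) \<partial>\<Omega>)"
      using meas by (subst nn_integral_distr[OF V_vec_meas]) (auto intro!: nn_integral_cong simp: integrand)
    finally show ?thesis .
  qed
  have psi: "ennreal (psi \<Omega> M Vc v) = \<mu>.eternal_prob v" if "v \<in> {1..M} \<rightarrow>\<^sub>E UNIV" for v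
    using that by (intro \<mu>.psi_eq_eternal_prob[OF prob Vc_indep])
      (simp_all add: Vc_distr \<mu>_def \<mu>.space_ereal_vec)

  let ?slack = "\<lambda>\<omega>. \<lambda>j\<in>{1..M}. ereal (x + (\<Sum>k=1..M. Yc (M + 1 - k) k \<omega>)
      - prefix_max M (\<lambda>l k. Yc l k \<omega>) j)"
  have slack: "?slack \<omega> \<in> {1..M} \<rightarrow>\<^sub>E UNIV" "j \<in> {1..M} \<Longrightarrow> ?slack \<omega> j \<noteq> -\<infinity>" for \<omega> j
    by auto
  have \<gamma>_bound: "ennreal (\<gamma> (?slack \<omega>)) \<le> \<mu>.eternal_prob (?slack \<omega>)" for \<omega>
  proof (rule \<mu>.submartingale_bound[OF \<gamma>_meas \<gamma>_le \<gamma>_infty \<gamma>_limsup _ slack])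
    fix v :: "nat \<Rightarrow> ereal" assume v: "v \<in> {1..M} \<rightarrow>\<^sub>E UNIV" "0 < \<gamma> v"
    then have "v \<in> support_on ({1..M} \<rightarrow>\<^sub>E UNIV) (\<lambda>v. max (\<gamma> v) 0)" by (simp add: support_on_def)
    then have "ereal (\<gamma> v) \<le> enn2ereal (\<mu>.step (\<lambda>v. ennreal (\<gamma> v)) v)"
      unfolding step_eq[OF \<gamma>_meas v(1)] by (rule order_trans[OF \<gamma>_sub expectation_ext_le])
    then show "ennreal (\<gamma> v) \<le> \<mu>.step (\<lambda>v. ennreal (\<gamma> v)) v"
      using v(2) by (simp add: less_eq_ennreal.rep_eq enn2ereal_ennreal)
  qed
  have \<eta>_bound: "\<mu>.eternal_prob (?slack \<omega>) \<le> ennreal (\<eta> (?slack \<omega>))" for \<omega>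
  proof (rule \<mu>.supermartingale_bound[OF \<eta>_meas \<eta>_infty \<eta>_liminf _ slack])
    fix v :: "nat \<Rightarrow> ereal" assume v: "v \<in> {1..M} \<rightarrow>\<^sub>E UNIV" "\<mu>.eternal_prob v \<noteq> 0"
    then have "v \<in> support_on ({1..M} \<rightarrow>\<^sub>E UNIV) (psi \<Omega> M Vc)"
      using psi[OF v(1)] by (auto simp: support_on_def)
    note \<eta>_super = \<eta>_super[OF this]
    have "shift_min M v w \<in> {1..M} \<rightarrow>\<^sub>E UNIV" for w
      using \<mu>.shift_min_in_space unfolding \<mu>.space_ereal_vec .
    then have "0 \<le> of_bool (v 1 \<ge> ereal (V 1 \<omega>)) * \<eta> (shift_min M v (\<lambda>j. V j \<omega>))" for \<omega>
      using \<eta>_nonneg by (intro mult_nonneg_nonneg zero_less_eq_of_bool) blast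
    from expectation_ext_nonneg[OF AE_I2[OF this]] \<eta>_super
    have "enn2ereal (\<mu>.step (\<lambda>v. ennreal (\<eta> v)) v) \<le> ereal (\<eta> v)"
      unfolding step_eq[OF \<eta>_meas v(1)] by (rule ord_eq_le_trans[OF sym])
    then show "\<mu>.step (\<lambda>v. ennreal (\<eta> v)) v \<le> ennreal (\<eta> v)"
      using \<eta>_nonneg[OF v(1)] by (simp add: less_eq_ennreal.rep_eq enn2ereal_ennreal)
  qed

  have Yc_family: "indep_vars (\<lambda>_. borel) (\<lambda>p. Yc (fst p) (snd p)) ({1..M} \<times> {1..M})"
    using Yc_indep by (simp add: case_prod_beta')
  have law_Yc: "distr \<Omega> (\<Pi>\<^sub>M p\<in>{1..M} \<times> {1..M}. borel) (\<lambda>\<omega>. \<lambda>p\<in>{1..M} \<times> {1..M}. Yc (fst p) (snd p) \<omega>) =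
      (\<Pi>\<^sub>M p\<in>{1..M} \<times> {1..M}. D (fst p))"
    using M by (intro distr_indep_family[OF Yc_family]) (auto simp: Yc_distr D_def)
  have Yc_meas: "(\<lambda>\<omega>. \<lambda>p\<in>{1..M} \<times> {1..M}. Yc (fst p) (snd p) \<omega>) \<in> \<Omega> \<rightarrow>\<^sub>M (\<Pi>\<^sub>M p\<in>{1..M} \<times> {1..M}. borel)"
    using Yc_family by (intro measurable_restrict) (auto simp: indep_vars_def)
  have slack_eq: "initial_slack M x (\<lambda>p\<in>{1..M} \<times> {1..M}. Yc (fst p) (snd p) \<omega>) = ?slack \<omega>" for \<omega>
  proof -
    have "initial_slack M x (\<lambda>p\<in>{1..M} \<times> {1..M}. Yc (fst p) (snd p) \<omega>) =
        initial_slack M x (\<lambda>p. Yc (fst p) (snd p) \<omega>)"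
      by (rule initial_slack_cong) simp
    then show ?thesis by (simp add: initial_slack_def)
  qed
  have W_le: "emeasure \<Omega> {\<omega> \<in> space \<Omega>. W \<omega> \<le> x} = (\<integral>\<^sup>+\<omega>. \<mu>.eternal_prob (?slack \<omega>) \<partial>\<Omega>)"
  proof -
    have service_nonneg: "AE \<omega> in \<Omega>. 0 \<le> s j 0 \<omega>" if j: "j \<in> {1..M}" for j
    proof -
      have s: "s j 0 \<in> borel_measurable \<Omega>"
        by (rule network_measurable(2)[OF network_indep j])
      have "AE t in distr \<Omega> borel (Y j). 0 \<le> t"
        using Y_nonneg[OF j] Y_meas[OF j] by (subst AE_distr_iff) auto
      then have "AE t in distr \<Omega> borel (s j 0). 0 \<le> t" unfolding s_distr[OF j] .
      then show ?thesis using s by (subst (asm) AE_distr_iff) auto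
    qed
    note meas = measurable_compose[OF initial_slack_measurable \<mu>.eternal_prob_measurable]
    have "emeasure \<Omega> {\<omega> \<in> space \<Omega>. W \<omega> \<le> x} =
        (\<integral>\<^sup>+y. \<mu>.eternal_prob (initial_slack M x y) \<partial>(\<Pi>\<^sub>M p\<in>{1..M} \<times> {1..M}. D (fst p)))"
      by (intro \<mu>.emeasure_stationary_waiting_time_le[OF prob network_indep _ _ \<mu> _ W_meas W_limit x])
        (simp_all add: Xs_distr s_distr D_def service_nonneg)
    also have "(\<integral>\<^sup>+y. \<mu>.eternal_prob (initial_slack M x y) \<partial>(\<Pi>\<^sub>M p\<in>{1..M} \<times> {1..M}. D (fst p))) =
        (\<integral>\<^sup>+\<omega>. \<mu>.eternal_prob (?slack \<omega>) \<partial>\<Omega>)"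
      unfolding law_Yc[symmetric]
      by (subst nn_integral_distr[OF Yc_meas])
        (simp_all only: slack_eq measurable_distr_eq1 meas)
    finally show ?thesis .
  qed
  define F where "F = prob {\<omega> \<in> space \<Omega>. W \<omega> \<le> x}"
  have F: "ennreal F = (\<integral>\<^sup>+\<omega>. \<mu>.eternal_prob (?slack \<omega>) \<partial>\<Omega>)" "0 \<le> F"
    using W_le by (simp_all add: F_def emeasure_eq_measure)
  have tail: "ereal (prob {\<omega> \<in> space \<Omega>. W \<omega> > x}) = 1 - ereal F"
  proof -
    have "{\<omega> \<in> space \<Omega>. W \<omega> > x} = space \<Omega> - {\<omega> \<in> space \<Omega>. W \<omega> \<le> x}" by auto
    then have "prob {\<omega> \<in> space \<Omega>. W \<omega> > x} = 1 - F"
      unfolding F_def using W_meas by (simp add: prob_compl)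
    then show ?thesis by (simp add: one_ereal_def)
  qed
  have "ereal F \<le> expectation_ext \<Omega> (\<lambda>\<omega>. \<eta> (?slack \<omega>))"
  proof -
    have "ennreal F \<le> (\<integral>\<^sup>+\<omega>. ennreal (\<eta> (?slack \<omega>)) \<partial>\<Omega>)"
      unfolding F(1) by (intro nn_integral_mono \<eta>_bound)
    moreover have "expectation_ext \<Omega> (\<lambda>\<omega>. \<eta> (?slack \<omega>)) = enn2ereal (\<integral>\<^sup>+\<omega>. ennreal (\<eta> (?slack \<omega>)) \<partial>\<Omega>)"
      by (rule expectation_ext_nonneg) (simp add: \<eta>_nonneg slack)
    ultimately show ?thesis using F(2) by (simp add: less_eq_ennreal.rep_eq enn2ereal_ennreal)
  qed
  moreover have "expectation_ext \<Omega> (\<lambda>\<omega>. \<gamma> (?slack \<omega>)) \<le> ereal F"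
  proof -
    have "(\<integral>\<^sup>+\<omega>. ennreal (\<gamma> (?slack \<omega>)) \<partial>\<Omega>) \<le> ennreal F"
      unfolding F(1) by (intro nn_integral_mono \<gamma>_bound)
    then have "enn2ereal (\<integral>\<^sup>+\<omega>. ennreal (\<gamma> (?slack \<omega>)) \<partial>\<Omega>) \<le> ereal F"
      using F(2) by (simp add: less_eq_ennreal.rep_eq enn2ereal_ennreal)
    then show ?thesis by (rule order_trans[OF expectation_ext_le])
  qed
  ultimately show ?thesis
    unfolding tail by (intro conjI ereal_minus_mono order_refl)
qed

end
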